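(* Let $(G_n)_{n=1}^\infty$ be a sequence of finite simple graphs with $|V(G_n)|\to\infty$, whose adjacency operators action converge to a $P$-operator $A\colon L^\infty(\Omega,\nu)\to L^1(\Omega,\nu)$, where $(\Omega,\nu)$ is a separable probability space. Then there is a $\nu$-filter $\mathcal{F}$ on $\Omega$ such that for any $\nu$-ultrafilter $\mathcal{U}$ extending $\mathcal{F}$, both \[ A^+\colon L^\infty(\Omega,\nu)\to L^1(\Omega,\nu),\quad (A^+g)(\omega)=(Ag)(\omega)+\phi_\mathcal{U}(g) \] and \[ A^-\colon L^\infty(\Omega,\nu)\to L^1(\Omega,\nu),\quad (A^-g)(\omega)=(Ag)(\omega)-\phi_\mathcal{U}(g) \] are action limits of $(G_n^+)_{n=1}^\infty$, i.e. $d_M(G_n^+,A^+)\to0$ and $d_M(G_n^+,A^-)\to0$.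
   Context: A $P$-operator is a linear operator $A\colon L^\infty(\Omega)\to L^1(\Omega)$, $(\Omega,\mathcal{A},\mu)$ a probability space, with $\|A\|_{\infty\to1}=\sup_{v}\|Av\|_1/\|v\|_\infty<\infty$. For $k\ge1$ the $k$-profile is $\mathcal{S}_k(A)=\{\mathcal{D}(f_1,\dots,f_k,Af_1,\dots,Af_k): f_1,\dots,f_k\in B_1^{L^\infty}\}\subset\mathcal{P}(\mathbb{R}^{2k})$, where $B_1^{L^\infty}$ is the closed unit ball of $L^\infty(\Omega)$ and $\mathcal{D}(\cdot)$ denotes the joint distribution (pushforward of $\mu$ under $\omega\mapsto(f_1(\omega),\dots,Af_k(\omega))$). $\mathcal{P}(\mathbb{R}^{2k})$ carries the Lévy–Prokhorov metric $d_{LP}(\eta,\mu)=\inf\{\varepsilon>0:\eta(U)\le\mu(U^\varepsilon)+\varepsilon,\ \mu(U)\le\eta(U^\varepsilon)+\varepsilon\ \forall\text{ Borel }U\}$, $U^\varepsilon$ the open $\varepsilon$-neighbourhood; $d_H$ is the Hausdorff (pseudo)distance between subsets of $\mathcal{P}(\mathbb{R}^{2k})$. The action distance is $d_M(A,B)=\sum_{k\ge1}2^{-k}d_H(\mathcal{S}_k(A),\mathcal{S}_k(B))$, and $A_n$ action converges to $A$ if $d_M(A_n,A)\to0$. A finite graph $G$ is identified with its adjacency operator on $L^\infty$ of the uniform probability space on $V(G)$: $(Gv)(x)=\sum_{y: xy\in E(G)}v(y)$. For a graph $G$, $G^+$ is the graph on $|V(G)|+1$ vertices obtained from $G$ by adding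 one new vertex adjacent to all vertices of $G$. A $\nu$-filter is a nonempty collection $\mathcal{F}$ of measurable sets such that every $S\in\mathcal{F}$ has $\nu(S)>0$, $S,T\in\mathcal{F}\Rightarrow S\cap T\in\mathcal{F}$, and $S\in\mathcal{F}$, $S\subset T$ measurable $\Rightarrow T\in\mathcal{F}$; a $\nu$-ultrafilter is a maximal $\nu$-filter. For a $\nu$-ultrafilter $\mathcal{U}$, $\phi_\mathcal{U}\colon L^\infty(\Omega,\nu)\to\mathbb{R}$ sends $f=\lim_{n}\sum_{i=1}^n\alpha_{n,i}\chi_{E_{n,i}}$ (limit of simple functions in $L^\infty$-norm) to $\lim_n\sum_{i=1}^n\alpha_{n,i}\mathds{1}_{E_{n,i}\in\mathcal{U}}$, i.e. $\phi_\mathcal{U}(f)=\int f\,d\delta_\mathcal{U}$ where $\delta_\mathcal{U}(E)=1$ if $E\in\mathcal{U}$ and $0$ otherwise. *)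

theory Defs
  imports "HOL-Probability.Probability"
begin

text \<open>Elements of \<open>L\<^sup>\<infinity>\<close> and \<open>L\<^sup>1\<close> are represented by functions; operators between these spaces
  are required to respect almost-everywhere equality.\<close>

definition Linf_norm :: "'a measure \<Rightarrow> ('a \<Rightarrow> real) \<Rightarrow> ereal" where
  "Linf_norm M f = esssup M (\<lambda>x. ereal \<bar>f x\<bar>)"

definition Linf :: "'a measure \<Rightarrow> ('a \<Rightarrow> real) set" where
  "Linf M = {f \<in> borel_measurable M. Linf_norm M f < \<infinity>}"

definition Linf_ball :: "'a measure \<Rightarrow> ('a \<Rightarrow> real) set" where
  "Linf_ball M = {f \<in> borel_measurable M. Linf_norm M f \<le> 1}"

definition L1_norm :: "'a measure \<Rightarrow> ('a \<Rightarrow> real) \<Rightarrow> real" where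
  "L1_norm M f = (\<integral>x. \<bar>f x\<bar> \<partial>M)"

type_synonym 'a operator = "('a \<Rightarrow> real) \<Rightarrow> 'a \<Rightarrow> real"

definition inf_1_norm :: "'a measure \<Rightarrow> 'a operator \<Rightarrow> ereal" where
  "inf_1_norm M A =
     (SUP v \<in> {v \<in> Linf M. Linf_norm M v \<noteq> 0}. ereal (L1_norm M (A v)) / Linf_norm M v)"

definition P_operator :: "'a measure \<Rightarrow> 'a operator \<Rightarrow> bool" where
  "P_operator M A \<longleftrightarrow>
     prob_space M \<and>
     (\<forall>f \<in> Linf M. integrable M (A f)) \<and>
     (\<forall>f \<in> Linf M. \<forall>g \<in> Linf M. (AE x in M. f x = g x) \<longrightarrow> (AE x in M. A f x = A g x)) \<and>
     (\<forall>f \<in> Linf M. \<forall>g \<in> Linf M. AE x in M. A (\<lambda>y. f y + g y) x = A f x + A g x) \<and>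
     (\<forall>c. \<forall>f \<in> Linf M. AE x in M. A (\<lambda>y. c * f y) x = c * A f x) \<and>
     inf_1_norm M A < \<infinity>"

text \<open>The Euclidean space of dimension \<open>d\<close> (with \<open>d\<close> a natural number over which one can
  quantify) is the set of extensional functions on \<open>{..<d}\<close>; its Borel sets form the
  product sigma-algebra.\<close>

abbreviation euclid :: "nat \<Rightarrow> (nat \<Rightarrow> real) measure" where
  "euclid d \<equiv> Pi\<^sub>M {..<d} (\<lambda>_. borel)"

definition euclid_dist :: "nat \<Rightarrow> (nat \<Rightarrow> real) \<Rightarrow> (nat \<Rightarrow> real) \<Rightarrow> real" where
  "euclid_dist d x y = L2_set (\<lambda>i. x i - y i) {..<d}"

definition open_nbhd :: "nat \<Rightarrow> real \<Rightarrow> (nat \<Rightarrow> real) set \<Rightarrow> (nat \<Rightarrow> real) set" where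
  "open_nbhd d \<epsilon> U = {x \<in> space (euclid d). \<exists>y \<in> U. euclid_dist d x y < \<epsilon>}"

definition LP_dist :: "nat \<Rightarrow> (nat \<Rightarrow> real) measure \<Rightarrow> (nat \<Rightarrow> real) measure \<Rightarrow> real" where
  "LP_dist d \<eta> \<mu> = Inf {\<epsilon>. \<epsilon> > 0 \<and> (\<forall>U \<in> sets (euclid d).
      measure \<eta> U \<le> measure \<mu> (open_nbhd d \<epsilon> U) + \<epsilon> \<and>
      measure \<mu> U \<le> measure \<eta> (open_nbhd d \<epsilon> U) + \<epsilon>)}"

definition hausdorff_dist :: "('b \<Rightarrow> 'b \<Rightarrow> real) \<Rightarrow> 'b set \<Rightarrow> 'b set \<Rightarrow> real" where
  "hausdorff_dist d X Y = max (SUP x \<in> X. INF y \<in> Y. d x y) (SUP y \<in> Y. INF x \<in> X. d x y)"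

definition joint_distr :: "'a measure \<Rightarrow> 'a operator \<Rightarrow> nat \<Rightarrow> (nat \<Rightarrow> 'a \<Rightarrow> real) \<Rightarrow> (nat \<Rightarrow> real) measure"
  where
  "joint_distr M A k f =
     distr M (euclid (2 * k))
       (\<lambda>\<omega>. \<lambda>i \<in> {..<2 * k}. if i < k then f i \<omega> else A (f (i - k)) \<omega>)"

definition profile :: "'a measure \<Rightarrow> 'a operator \<Rightarrow> nat \<Rightarrow> (nat \<Rightarrow> real) measure set" where
  "profile M A k = {joint_distr M A k f | f. \<forall>i < k. f i \<in> Linf_ball M}"

definition action_dist :: "'a measure \<Rightarrow> 'a operator \<Rightarrow> 'b measure \<Rightarrow> 'b operator \<Rightarrow> real" where
  "action_dist M A N B =
     (\<Sum>j. let k = Suc j in (1 / 2) ^ k * hausdorff_dist (LP_dist (2 * k)) (profile M A k) (profile N B k))"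

definition action_converges ::
  "(nat \<Rightarrow> 'a measure) \<Rightarrow> (nat \<Rightarrow> 'a operator) \<Rightarrow> 'b measure \<Rightarrow> 'b operator \<Rightarrow> bool" where
  "action_converges Ms As M A \<longleftrightarrow>
     (\<forall>n. P_operator (Ms n) (As n)) \<and> P_operator M A \<and>
     (\<lambda>n. action_dist (Ms n) (As n) M A) \<longlonglongrightarrow> 0"

record 'v graph =
  verts :: "'v set"
  edges :: "'v set set"

definition finite_simple_graph :: "'v graph \<Rightarrow> bool" where
  "finite_simple_graph G \<longleftrightarrow>
     finite (verts G) \<and> verts G \<noteq> {} \<and> edges G \<subseteq> {e. e \<subseteq> verts G \<and> card e = 2}"

definition adj_operator :: "'v graph \<Rightarrow> 'v operator" where
  "adj_operator G v x = (\<Sum>y \<in> {y \<in> verts G. {x, y} \<in> edges G}. v y)"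

text \<open>The new vertex is \<open>None\<close>.\<close>

definition cone_graph :: "'v graph \<Rightarrow> 'v option graph" where
  "cone_graph G =
     \<lparr>verts = insert None (Some ` verts G),
      edges = (\<lambda>e. Some ` e) ` edges G \<union> {{None, Some x} | x. x \<in> verts G}\<rparr>"

definition graphs_action_converge :: "(nat \<Rightarrow> 'v graph) \<Rightarrow> 'a measure \<Rightarrow> 'a operator \<Rightarrow> bool" where
  "graphs_action_converge G M A \<longleftrightarrow>
     action_converges (\<lambda>n. uniform_count_measure (verts (G n))) (\<lambda>n. adj_operator (G n)) M A"

text \<open>Separability of the measure algebra with the metric \<open>\<nu>(E \<triangle> D)\<close>, equivalently of \<open>L\<^sup>1\<close>.\<close>

definition separable_measure :: "'a measure \<Rightarrow> bool" where
  "separable_measure M \<longleftrightarrow>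
     (\<exists>\<D> \<subseteq> sets M. countable \<D> \<and>
        (\<forall>E \<in> sets M. \<forall>\<epsilon> > 0. \<exists>D \<in> \<D>. measure M ((E - D) \<union> (D - E)) < \<epsilon>))"

definition measure_filter :: "'a measure \<Rightarrow> 'a set set \<Rightarrow> bool" where
  "measure_filter M \<F> \<longleftrightarrow>
     \<F> \<noteq> {} \<and> \<F> \<subseteq> sets M \<and>
     (\<forall>S \<in> \<F>. measure M S > 0) \<and>
     (\<forall>S \<in> \<F>. \<forall>T \<in> \<F>. S \<inter> T \<in> \<F>) \<and>
     (\<forall>S \<in> \<F>. \<forall>T \<in> sets M. S \<subseteq> T \<longrightarrow> T \<in> \<F>)"

definition measure_ultrafilter :: "'a measure \<Rightarrow> 'a set set \<Rightarrow> bool" where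
  "measure_ultrafilter M \<U> \<longleftrightarrow>
     measure_filter M \<U> \<and> (\<forall>\<F>. measure_filter M \<F> \<and> \<U> \<subseteq> \<F> \<longrightarrow> \<F> = \<U>)"

definition uf_integral :: "'a measure \<Rightarrow> 'a set set \<Rightarrow> ('a \<Rightarrow> real) \<Rightarrow> real" where
  "uf_integral M \<U> f = (THE c. \<exists>(\<alpha> :: nat \<Rightarrow> nat \<Rightarrow> real) E.
      (\<forall>n i. E n i \<in> sets M) \<and>
      (\<lambda>n. Linf_norm M (\<lambda>x. f x - (\<Sum>i = 1..n. \<alpha> n i * indicator (E n i) x))) \<longlonglongrightarrow> 0 \<and>
      (\<lambda>n. \<Sum>i = 1..n. \<alpha> n i * (if E n i \<in> \<U> then 1 else 0)) \<longlonglongrightarrow> c)"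

end

theory Submission
  imports Defs
begin

text \<open>The new vertex of \<open>G\<^sub>n\<^sup>+\<close> has vanishing mass, and its value \<open>c \<in> [-1, 1]\<close> is added to every
  \<open>G\<^sub>n f\<close>; so the profiles of \<open>G\<^sub>n\<^sup>+\<close> are asymptotically those of \<open>(f, A f + c)\<close> with \<open>c\<close> free.
  To realise them by \<open>A\<^sup>\<plusminus>\<close> one has to prescribe \<open>\<phi>\<^sub>\<U>(f)\<close> while hardly moving \<open>f\<close> and \<open>A f\<close>.
  This is done by overwriting \<open>f\<close> with a constant on a set \<open>R \<in> \<F>\<close> of small measure on which \<open>A\<close>
  is uniformly small, that is, \<open>\<parallel>A h\<parallel>\<^sub>1\<close> is small whenever \<open>\<bar>h\<bar> \<le> 1\<^sub>R\<close>.

  Such sets exist because \<open>L\<^sup>1\<close> has cotype 2: Khintchine's inequality shows that a bounded operator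
  \<open>L\<^sup>\<infinity> \<rightarrow> L\<^sup>1\<close> is uniformly small on all but finitely many members of any disjoint sequence of sets.
  As \<open>A\<close> need not be countably additive, this is applied to unions over infinite index sets:
  splitting an infinite index set into infinitely many infinite parts, one of the parts has a union on
  which \<open>A\<close> is small, and iterating gives a decreasing sequence of sets that generates \<open>\<F>\<close>.
  An infinite disjoint sequence of sets of positive measure exists because \<open>|V(G\<^sub>n)| \<rightarrow> \<infinity>\<close>.\<close>

section \<open>Levy-Prokhorov closeness and profiles\<close>

text \<open>Why the scalar is free: a profile sees \<open>f\<close> and \<open>A f\<close> only up
  to sets of small measure, whereas \<open>\<phi>\<close> of \<open>f\<close> is determined by the
  values of \<open>f\<close> on a single member of \<U>, however small. So the numbers
  \<open>\<phi> f\<^sub>i\<close> can be tuned to any values in [-1, 1] without visible change, and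
  both signs work because that interval is symmetric. The obstacle is \<open>A\<close> itself. An
  operator bounded only from \<open>L\<^sup>\<infinity>\<close> to \<open>L\<^sup>1\<close> may
  react strongly to a change on a set of tiny measure; operators of the form
  \<open>A\<^sup>+\<close> are examples, since the functional does not get smaller with the set.
  Small measure of the overwritten set is therefore not enough, and an arbitrary ultrafilter could
  sit exactly where \<open>A\<close> has such a concentrated part. The filter \<F> is there to steer
  away from it: a fixed amount of concentration fits on only finitely many of any sequence of
  disjoint sets, so some region is free of it. The overwritten sets depend on \<F> alone, which is
  why one filter serves all ultrafilters extending it.\<close>

definition LP_close :: "nat \<Rightarrow> real \<Rightarrow> (nat \<Rightarrow> real) measure \<Rightarrow> (nat \<Rightarrow> real) measure \<Rightarrow> bool" where
  "LP_close d \<epsilon> \<eta> \<mu> \<longleftrightarrow> (\<forall>U \<in> sets (euclid d).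
      measure \<eta> U \<le> measure \<mu> (open_nbhd d \<epsilon> U) + \<epsilon> \<and>
      measure \<mu> U \<le> measure \<eta> (open_nbhd d \<epsilon> U) + \<epsilon>)"

text \<open>Estimates are made at a fixed radius, where they compose as plain inequalities; the
  infimum is entered and left mainly through \<open>LP_dist_lessD\<close> and
  \<open>LP_dist_le\<close>.\<close>

lemma LP_dist_eq_Inf: "LP_dist d \<eta> \<mu> = Inf {\<epsilon>. 0 < \<epsilon> \<and> LP_close d \<epsilon> \<eta> \<mu>}"
  by (simp add: LP_dist_def LP_close_def)

lemma euclid_dist_commute: "euclid_dist d x y = euclid_dist d y x"
  unfolding euclid_dist_def L2_set_def by (intro arg_cong[where f = sqrt] sum.cong refl power2_commute)

lemma euclid_dist_triangle: "euclid_dist d x z \<le> euclid_dist d x y + euclid_dist d y z"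
proof -
  have "L2_set (\<lambda>i. x i - z i) {..<d} = L2_set (\<lambda>i. (x i - y i) + (y i - z i)) {..<d}"
    by simp
  then show ?thesis
    unfolding euclid_dist_def using L2_set_triangle_ineq by metis
qed

lemma euclid_dist_self [simp]: "euclid_dist d x x = 0"
  by (simp add: euclid_dist_def L2_set_def)

lemma euclid_dist_le_sum: "euclid_dist d x y \<le> (\<Sum>i<d. \<bar>x i - y i\<bar>)"
  unfolding euclid_dist_def by (rule L2_set_le_sum_abs)

lemma abs_diff_le_euclid_dist: "i < d \<Longrightarrow> \<bar>x i - y i\<bar> \<le> euclid_dist d x y"
  unfolding euclid_dist_def
  using member_le_L2_set[of "{..<d}" i "\<lambda>i. \<bar>x i - y i\<bar>"] by (simp add: L2_set_def)

text \<open>Second countability: a neighbourhood is the union of the balls with rational centre and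
  rational radius that it contains, and a ball is measurable as a sublevel set of the
  distance.\<close>

lemma open_nbhd_in_sets [measurable]: "open_nbhd d \<epsilon> U \<in> sets (euclid d)"
proof -
  define Q where "Q = (PiE {..<d} (\<lambda>_. \<rat>) :: (nat \<Rightarrow> real) set)"
  define B where "B = (\<lambda>(q, r). {x \<in> space (euclid d). euclid_dist d x q < r})"
  define I where "I = {p \<in> Q \<times> \<rat>. B p \<subseteq> open_nbhd d \<epsilon> U}"
  have B_sets: "B p \<in> sets (euclid d)" if "p \<in> I" for p
    unfolding B_def split_beta euclid_dist_def L2_set_def by measurable
  have "countable I"
  proof -
    have "countable Q"
      unfolding Q_def by (intro countable_PiE) (auto simp: countable_rat)
    then show ?thesis
      unfolding I_def by (intro countable_subset[OF _ countable_SIGMA[of Q "\<lambda>_. \<rat>"]])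
        (auto simp: countable_rat)
  qed
  moreover have "open_nbhd d \<epsilon> U = (\<Union>p\<in>I. B p)"
  proof (intro equalityI subsetI)
    fix x assume x: "x \<in> open_nbhd d \<epsilon> U"
    then obtain y where y: "y \<in> U" "euclid_dist d x y < \<epsilon>" and xs: "x \<in> space (euclid d)"
      by (auto simp: open_nbhd_def)
    \<comment> \<open>Going from a point of the ball around \<open>q'\<close> through
      \<open>q'\<close> and \<open>x\<close> to \<open>y\<close> costs \<open>2 * r\<close> on top
      of \<open>euclid_dist d x y\<close>, so \<open>r\<close> is kept below half of the
      slack.\<close>
    obtain r where r: "r \<in> \<rat>" "0 < r" "r < (\<epsilon> - euclid_dist d x y) / 2"
      using Rats_dense_in_real[of 0 "(\<epsilon> - euclid_dist d x y) / 2"] y by auto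
    \<comment> \<open>With an error below \<open>r / (d + 1)\<close> in each coordinate, the sum of
      the \<open>d\<close> errors stays strictly below \<open>r\<close>.\<close>
    have "\<exists>q\<in>\<rat>. x i < q \<and> q < x i + r / (real d + 1)" for i
      using Rats_dense_in_real[of "x i" "x i + r / (real d + 1)"] r by auto
    then obtain q where q: "\<And>i. q i \<in> \<rat>" "\<And>i. x i < q i" "\<And>i. q i < x i + r / (real d + 1)"
      by metis
    define q' where "q' = restrict q {..<d}"
    have "euclid_dist d x q' \<le> (\<Sum>i<d. \<bar>x i - q' i\<bar>)"
      by (rule euclid_dist_le_sum)
    also have "\<dots> \<le> (\<Sum>i<d. r / (real d + 1))"
      by (rule sum_mono) (use q in \<open>auto simp: q'_def abs_if less_imp_le algebra_simps\<close>)
    also have "\<dots> < r"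
      using r by (simp add: field_simps)
    finally have xq: "euclid_dist d x q' < r" .
    have "(q', r) \<in> I"
    proof -
      have "q' \<in> Q" using q by (auto simp: Q_def q'_def)
      moreover have "B (q', r) \<subseteq> open_nbhd d \<epsilon> U"
      proof
        fix z assume z: "z \<in> B (q', r)"
        have "euclid_dist d z y \<le> euclid_dist d z q' + (euclid_dist d q' x + euclid_dist d x y)"
          using euclid_dist_triangle[of d z y q'] euclid_dist_triangle[of d q' y x] by linarith
        also have "\<dots> < r + (r + euclid_dist d x y)"
          using z xq euclid_dist_commute[of d q' x] by (auto simp: B_def)
        also have "\<dots> < \<epsilon>" using r by (simp add: field_simps)
        finally show "z \<in> open_nbhd d \<epsilon> U"
          using z y by (auto simp: B_def open_nbhd_def)
      qed
      ultimately show ?thesis using r by (auto simp: I_def)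
    qed
    then show "x \<in> (\<Union>p\<in>I. B p)"
      using xq xs by (intro UN_I) (auto simp: B_def)
  qed (auto simp: I_def)
  ultimately show ?thesis
    using B_sets by (auto intro: sets.countable_UN')
qed

lemma open_nbhd_mono: "\<epsilon> \<le> \<delta> \<Longrightarrow> open_nbhd d \<epsilon> U \<subseteq> open_nbhd d \<delta> U"
  by (auto simp: open_nbhd_def intro: less_le_trans)

lemma subset_open_nbhd: "U \<in> sets (euclid d) \<Longrightarrow> 0 < \<epsilon> \<Longrightarrow> U \<subseteq> open_nbhd d \<epsilon> U"
  using sets.sets_into_space[of U "euclid d"] by (force simp: open_nbhd_def)

lemma open_nbhd_open_nbhd: "open_nbhd d \<epsilon> (open_nbhd d \<delta> U) \<subseteq> open_nbhd d (\<epsilon> + \<delta>) U"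
proof
  fix x assume "x \<in> open_nbhd d \<epsilon> (open_nbhd d \<delta> U)"
  then obtain y z where "x \<in> space (euclid d)" "euclid_dist d x y < \<epsilon>" "z \<in> U" "euclid_dist d y z < \<delta>"
    by (auto simp: open_nbhd_def)
  then show "x \<in> open_nbhd d (\<epsilon> + \<delta>) U"
    using euclid_dist_triangle[of d x z y] by (force simp: open_nbhd_def)
qed

definition euclid_prob :: "nat \<Rightarrow> (nat \<Rightarrow> real) measure \<Rightarrow> bool" where
  "euclid_prob d \<mu> \<longleftrightarrow> prob_space \<mu> \<and> sets \<mu> = sets (euclid d)"

lemma euclid_prob_mono:
  assumes "euclid_prob d \<mu>" "U \<subseteq> V" "V \<in> sets (euclid d)"
  shows "measure \<mu> U \<le> measure \<mu> V"
proof -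
  interpret prob_space \<mu> using assms by (simp add: euclid_prob_def)
  show ?thesis using assms by (intro finite_measure_mono) (auto simp: euclid_prob_def)
qed

lemma LP_close_sym: "LP_close d \<epsilon> \<eta> \<mu> \<longleftrightarrow> LP_close d \<epsilon> \<mu> \<eta>"
  by (auto simp: LP_close_def)

lemma LP_close_mono:
  assumes "LP_close d \<epsilon> \<eta> \<mu>" "\<epsilon> \<le> \<delta>" "euclid_prob d \<eta>" "euclid_prob d \<mu>"
  shows "LP_close d \<delta> \<eta> \<mu>"
  unfolding LP_close_def
proof (intro ballI conjI)
  fix U assume U: "U \<in> sets (euclid d)"
  have "measure \<mu> (open_nbhd d \<epsilon> U) \<le> measure \<mu> (open_nbhd d \<delta> U)"
    "measure \<eta> (open_nbhd d \<epsilon> U) \<le> measure \<eta> (open_nbhd d \<delta> U)"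
    using assms by (auto intro!: euclid_prob_mono open_nbhd_mono open_nbhd_in_sets)
  then show "measure \<eta> U \<le> measure \<mu> (open_nbhd d \<delta> U) + \<delta>"
    "measure \<mu> U \<le> measure \<eta> (open_nbhd d \<delta> U) + \<delta>"
    using assms(1,2) U by (fastforce simp: LP_close_def)+
qed

lemma LP_close_trans:
  assumes "LP_close d \<epsilon> \<eta> \<mu>" "LP_close d \<delta> \<mu> \<theta>" "euclid_prob d \<eta>" "euclid_prob d \<theta>"
  shows "LP_close d (\<epsilon> + \<delta>) \<eta> \<theta>"
proof -
  have half: "measure \<eta> U \<le> measure \<theta> (open_nbhd d (\<epsilon> + \<delta>) U) + (\<epsilon> + \<delta>)"
    if "LP_close d \<epsilon> \<eta> \<mu>" "LP_close d \<delta> \<mu> \<theta>" "euclid_prob d \<theta>" "U \<in> sets (euclid d)"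
    for \<epsilon> \<delta> \<eta> \<theta> U
  proof -
    have "measure \<eta> U \<le> measure \<mu> (open_nbhd d \<epsilon> U) + \<epsilon>"
      using that by (auto simp: LP_close_def)
    also have "measure \<mu> (open_nbhd d \<epsilon> U) \<le> measure \<theta> (open_nbhd d \<delta> (open_nbhd d \<epsilon> U)) + \<delta>"
      using that by (auto simp: LP_close_def)
    also have "measure \<theta> (open_nbhd d \<delta> (open_nbhd d \<epsilon> U)) \<le> measure \<theta> (open_nbhd d (\<delta> + \<epsilon>) U)"
      using that(3) by (intro euclid_prob_mono) (auto intro!: open_nbhd_in_sets set_mp[OF open_nbhd_open_nbhd])
    finally show ?thesis by (simp add: add.commute)
  qed
  show ?thesis
    unfolding LP_close_def
    using half[OF assms(1,2,4)] half[of \<delta> \<theta> \<epsilon> \<eta>] assms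
    by (auto simp: LP_close_sym[of d _ \<theta>] LP_close_sym[of d _ \<mu> \<eta>] add.commute)
qed

lemma euclid_prob_distr:
  assumes "prob_space M" "X \<in> measurable M (euclid d)"
  shows "euclid_prob d (distr M (euclid d) X)"
  using assms by (auto simp: euclid_prob_def intro: prob_space.prob_space_distr)

text \<open>\<open>X\<close> and \<open>Y\<close> live on one space and so form a coupling; this is
  the elementary bound of the Levy-Prokhorov distance by the Ky Fan distance. A point that
  \<open>X\<close> sends into \<open>U\<close> either lies in \<open>B\<close> or is sent by
  \<open>Y\<close> into the neighbourhood of \<open>U\<close>.\<close>

lemma LP_close_distr:
  assumes "prob_space M" and X: "X \<in> measurable M (euclid d)" and Y: "Y \<in> measurable M (euclid d)"
    and B: "B \<in> sets M" "measure M B \<le> \<epsilon>"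
    and close: "\<And>\<omega>. \<omega> \<in> space M - B \<Longrightarrow> euclid_dist d (X \<omega>) (Y \<omega>) < \<epsilon>"
  shows "LP_close d \<epsilon> (distr M (euclid d) X) (distr M (euclid d) Y)"
proof -
  interpret prob_space M by fact
  have half: "measure (distr M (euclid d) X) U \<le> measure (distr M (euclid d) Y) (open_nbhd d \<epsilon> U) + \<epsilon>"
    if X: "X \<in> measurable M (euclid d)" and Y: "Y \<in> measurable M (euclid d)" and U: "U \<in> sets (euclid d)"
      and close: "\<And>\<omega>. \<omega> \<in> space M - B \<Longrightarrow> euclid_dist d (X \<omega>) (Y \<omega>) < \<epsilon>" for X Y U
  proof -
    have sub: "X -` U \<inter> space M \<subseteq> (Y -` open_nbhd d \<epsilon> U \<inter> space M) \<union> B"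
    proof
      fix \<omega> assume w: "\<omega> \<in> X -` U \<inter> space M"
      have "Y \<omega> \<in> open_nbhd d \<epsilon> U" if "\<omega> \<notin> B"
        using w that close[of \<omega>] measurable_space[OF Y, of \<omega>]
        by (auto simp: open_nbhd_def euclid_dist_commute)
      then show "\<omega> \<in> (Y -` open_nbhd d \<epsilon> U \<inter> space M) \<union> B" using w by auto
    qed
    have m: "Y -` open_nbhd d \<epsilon> U \<inter> space M \<in> sets M"
      using Y open_nbhd_in_sets by (rule measurable_sets)
    have "measure M (X -` U \<inter> space M) \<le> measure M ((Y -` open_nbhd d \<epsilon> U \<inter> space M) \<union> B)"
      by (rule finite_measure_mono[OF sub]) (use m B in auto)
    also have "\<dots> \<le> measure M (Y -` open_nbhd d \<epsilon> U \<inter> space M) + measure M B"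
      by (rule measure_Un_le) (use m B in auto)
    finally show ?thesis
      using B U by (simp add: measure_distr X Y open_nbhd_in_sets)
  qed
  show ?thesis
    unfolding LP_close_def using half[OF X Y _ close] half[OF Y X _]  close
    by (auto simp: euclid_dist_commute)
qed

section \<open>Translations of Euclidean space\<close>

definition translate :: "nat \<Rightarrow> (nat \<Rightarrow> real) \<Rightarrow> (nat \<Rightarrow> real) \<Rightarrow> nat \<Rightarrow> real" where
  "translate d c x = (\<lambda>i\<in>{..<d}. x i + c i)"

lemma euclid_dist_translate [simp]: "euclid_dist d (translate d c x) (translate d c y) = euclid_dist d x y"
  unfolding euclid_dist_def by (rule L2_set_cong) (auto simp: translate_def)

lemma measurable_translate [measurable]: "translate d c \<in> measurable (euclid d) (euclid d)"
  unfolding translate_def by measurable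

text \<open>A translation is an isometry, so the neighbourhood of a preimage lies in the preimage of
  the neighbourhood. Both measures are moved by the same vector \<open>c\<close>, hence scalars
  coming from the new vertex can be added at no cost.\<close>

lemma measure_translate_le:
  assumes cl: "LP_close d \<epsilon> (distr M (euclid d) X) (distr N (euclid d) Y)"
    and "prob_space N"
    and X: "X \<in> measurable M (euclid d)" and Y: "Y \<in> measurable N (euclid d)"
    and U: "U \<in> sets (euclid d)"
  shows "measure (distr M (euclid d) (\<lambda>\<omega>. translate d c (X \<omega>))) U
      \<le> measure (distr N (euclid d) (\<lambda>\<omega>. translate d c (Y \<omega>))) (open_nbhd d \<epsilon> U) + \<epsilon>"
proof -
  let ?T = "translate d c"
  let ?V = "?T -` U \<inter> space (euclid d)" and ?W = "?T -` open_nbhd d \<epsilon> U \<inter> space (euclid d)"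
  note [measurable] = X Y
  have V: "?V \<in> sets (euclid d)" using measurable_sets[OF measurable_translate U] .
  have W: "?W \<in> sets (euclid d)" using measurable_sets[OF measurable_translate open_nbhd_in_sets] .
  have dist: "distr L (euclid d) (\<lambda>\<omega>. ?T (Z \<omega>)) = distr (distr L (euclid d) Z) (euclid d) ?T"
    if "Z \<in> measurable L (euclid d)" for L :: "'w measure" and Z
    using that by (subst distr_distr) (auto simp: o_def)
  have "open_nbhd d \<epsilon> ?V \<subseteq> ?W"
  proof
    fix x assume "x \<in> open_nbhd d \<epsilon> ?V"
    then obtain y where x: "x \<in> space (euclid d)" and "?T y \<in> U" "euclid_dist d (?T x) (?T y) < \<epsilon>"
      by (auto simp: open_nbhd_def)
    then have "?T x \<in> open_nbhd d \<epsilon> U"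
      using measurable_space[OF measurable_translate x, of c] unfolding open_nbhd_def by blast
    then show "x \<in> ?W" using x by simp
  qed
  then have "measure (distr N (euclid d) Y) (open_nbhd d \<epsilon> ?V) \<le> measure (distr N (euclid d) Y) ?W"
    using W assms by (intro euclid_prob_mono[OF euclid_prob_distr]) auto
  moreover have "measure (distr M (euclid d) X) ?V
      \<le> measure (distr N (euclid d) Y) (open_nbhd d \<epsilon> ?V) + \<epsilon>"
    using cl V by (auto simp: LP_close_def)
  ultimately show ?thesis
    using U unfolding dist[OF X] dist[OF Y] by (simp add: measure_distr open_nbhd_in_sets)
qed

lemma LP_close_translate:
  assumes "LP_close d \<epsilon> (distr M (euclid d) X) (distr N (euclid d) Y)"
    and "prob_space M" "prob_space N"
    and "X \<in> measurable M (euclid d)" "Y \<in> measurable N (euclid d)"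
  shows "LP_close d \<epsilon> (distr M (euclid d) (\<lambda>\<omega>. translate d c (X \<omega>)))
    (distr N (euclid d) (\<lambda>\<omega>. translate d c (Y \<omega>)))"
  unfolding LP_close_def
  using measure_translate_le[OF assms(1,3,4,5)]
    measure_translate_le[OF iffD1[OF LP_close_sym assms(1)] assms(2,5,4)] by auto

text \<open>The set of admissible radii is never empty, so its infimum in the reals is meaningful
  and distances are at most 1. That bound later keeps the suprema bounded and the weighted series
  convergent.\<close>

lemma LP_close_one: "euclid_prob d \<eta> \<Longrightarrow> euclid_prob d \<mu> \<Longrightarrow> LP_close d 1 \<eta> \<mu>"
  unfolding LP_close_def euclid_prob_def
  by (metis add_increasing measure_nonneg prob_space.prob_le_1)

lemma LP_dist_le: "LP_close d \<epsilon> \<eta> \<mu> \<Longrightarrow> 0 < \<epsilon> \<Longrightarrow> LP_dist d \<eta> \<mu> \<le> \<epsilon>"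
  unfolding LP_dist_eq_Inf by (rule cInf_lower) (auto intro: bdd_belowI[of _ 0])

lemma LP_dist_le_one: "euclid_prob d \<eta> \<Longrightarrow> euclid_prob d \<mu> \<Longrightarrow> LP_dist d \<eta> \<mu> \<le> 1"
  using LP_dist_le[OF LP_close_one] by simp

lemma LP_dist_nonneg: "euclid_prob d \<eta> \<Longrightarrow> euclid_prob d \<mu> \<Longrightarrow> 0 \<le> LP_dist d \<eta> \<mu>"
  unfolding LP_dist_eq_Inf
  by (rule cInf_greatest) (use LP_close_one in \<open>auto intro!: exI[of _ 1]\<close>)

lemma LP_dist_lessD:
  assumes "LP_dist d \<eta> \<mu> < \<epsilon>" "euclid_prob d \<eta>" "euclid_prob d \<mu>"
  shows "LP_close d \<epsilon> \<eta> \<mu>"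
proof -
  have "{\<epsilon>. 0 < \<epsilon> \<and> LP_close d \<epsilon> \<eta> \<mu>} \<noteq> {}"
    using LP_close_one[OF assms(2,3)] by (auto intro!: exI[of _ 1])
  from cInf_lessD[OF this] obtain \<delta> where "\<delta> < \<epsilon>" "LP_close d \<delta> \<eta> \<mu>"
    using assms(1) by (auto simp: LP_dist_eq_Inf)
  then show ?thesis using LP_close_mono assms by fastforce
qed

section \<open>Hausdorff distance for distances with values in [0, 1]\<close>

context
  fixes d :: "'b \<Rightarrow> 'b \<Rightarrow> real" and X Y :: "'b set"
  assumes d01: "\<forall>x\<in>X. \<forall>y\<in>Y. 0 \<le> d x y \<and> d x y \<le> 1"
    and ne: "X \<noteq> {}" "Y \<noteq> {}"
begin

lemma INF_bounds:
  shows "x \<in> X \<Longrightarrow> 0 \<le> (INF y\<in>Y. d x y) \<and> (INF y\<in>Y. d x y) \<le> 1"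
    and "y \<in> Y \<Longrightarrow> 0 \<le> (INF x\<in>X. d x y) \<and> (INF x\<in>X. d x y) \<le> 1"
proof -
  obtain x0 y0 where 0: "x0 \<in> X" "y0 \<in> Y" using ne by auto
  show "0 \<le> (INF y\<in>Y. d x y) \<and> (INF y\<in>Y. d x y) \<le> 1" if "x \<in> X"
    using that ne d01 0 by (auto intro!: cINF_greatest cINF_lower2[of _ _ y0] bdd_belowI2[of _ 0])
  show "0 \<le> (INF x\<in>X. d x y) \<and> (INF x\<in>X. d x y) \<le> 1" if "y \<in> Y"
    using that ne d01 0 by (auto intro!: cINF_greatest cINF_lower2[of _ _ x0] bdd_belowI2[of _ 0])
qed

lemma bdd_above_INF:
  "bdd_above ((\<lambda>x. INF y\<in>Y. d x y) ` X)" "bdd_above ((\<lambda>y. INF x\<in>X. d x y) ` Y)"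
  using INF_bounds by (auto intro!: bdd_aboveI2[of _ _ 1])

lemma hausdorff_dist_le:
  assumes "\<And>x. x \<in> X \<Longrightarrow> \<exists>y\<in>Y. d x y \<le> e" "\<And>y. y \<in> Y \<Longrightarrow> \<exists>x\<in>X. d x y \<le> e"
  shows "hausdorff_dist d X Y \<le> e"
proof -
  have "(INF y\<in>Y. d x y) \<le> e" if x: "x \<in> X" for x
  proof -
    obtain y where "y \<in> Y" "d x y \<le> e" using assms(1) x by auto
    then show ?thesis using x d01 by (auto intro!: cINF_lower2[of _ _ y] bdd_belowI2[of _ 0])
  qed
  moreover have "(INF x\<in>X. d x y) \<le> e" if y: "y \<in> Y" for y
  proof -
    obtain x where "x \<in> X" "d x y \<le> e" using assms(2) y by auto
    then show ?thesis using y d01 by (auto intro!: cINF_lower2[of _ _ x] bdd_belowI2[of _ 0])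
  qed
  ultimately show ?thesis
    unfolding hausdorff_dist_def using ne by (auto intro!: cSUP_least)
qed

lemma hausdorff_dist_le_one: "hausdorff_dist d X Y \<le> 1"
  by (rule hausdorff_dist_le) (use d01 ne in blast)+

lemma hausdorff_dist_nonneg: "0 \<le> hausdorff_dist d X Y"
proof -
  obtain x0 where 0: "x0 \<in> X" using ne by auto
  have "0 \<le> (SUP x\<in>X. INF y\<in>Y. d x y)"
    using INF_bounds(1)[OF 0] bdd_above_INF 0 by (intro cSUP_upper2[of _ _ x0]) auto
  then show ?thesis unfolding hausdorff_dist_def by linarith
qed

lemma hausdorff_dist_lessD:
  assumes "hausdorff_dist d X Y < e"
  shows "x \<in> X \<Longrightarrow> \<exists>y\<in>Y. d x y < e" "y \<in> Y \<Longrightarrow> \<exists>x\<in>X. d x y < e"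
proof -
  have 1: "(SUP x\<in>X. INF y\<in>Y. d x y) < e" and 2: "(SUP y\<in>Y. INF x\<in>X. d x y) < e"
    using assms by (auto simp: hausdorff_dist_def)
  show "\<exists>y\<in>Y. d x y < e" if "x \<in> X"
    using cInf_lessD[of "(\<lambda>y. d x y) ` Y" e] cSUP_upper[OF that bdd_above_INF(1)] 1 ne by force
  show "\<exists>x\<in>X. d x y < e" if "y \<in> Y"
    using cInf_lessD[of "(\<lambda>x. d x y) ` X" e] cSUP_upper[OF that bdd_above_INF(2)] 2 ne by force
qed

end

section \<open>Profiles as sets of pushforward measures\<close>

definition profile_vec :: "'a operator \<Rightarrow> nat \<Rightarrow> (nat \<Rightarrow> 'a \<Rightarrow> real) \<Rightarrow> 'a \<Rightarrow> nat \<Rightarrow> real" where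
  "profile_vec A k f \<omega> = (\<lambda>i\<in>{..<2 * k}. if i < k then f i \<omega> else A (f (i - k)) \<omega>)"

lemma joint_distr_eq: "joint_distr M A k f = distr M (euclid (2 * k)) (profile_vec A k f)"
  by (simp add: joint_distr_def profile_vec_def[abs_def])

lemma Linf_ball_subset_Linf: "Linf_ball M \<subseteq> Linf M"
  by (force simp: Linf_ball_def Linf_def intro: le_less_trans)

lemma measurable_profile_vec:
  assumes "P_operator M A" "\<forall>i<k. f i \<in> Linf_ball M"
  shows "profile_vec A k f \<in> measurable M (euclid (2 * k))"
  unfolding profile_vec_def
proof (rule measurable_restrict)
  fix i assume i: "i \<in> {..<2 * k}"
  have "A (f (i - k)) \<in> borel_measurable M" if "\<not> i < k"
  proof -
    have "f (i - k) \<in> Linf M" using assms(2) i that Linf_ball_subset_Linf by force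
    then show ?thesis using assms(1) by (auto simp: P_operator_def)
  qed
  moreover have "f i \<in> borel_measurable M" if "i < k"
    using assms that by (auto simp: Linf_ball_def)
  ultimately show "(\<lambda>\<omega>. if i < k then f i \<omega> else A (f (i - k)) \<omega>) \<in> borel_measurable M"
    by (cases "i < k") auto
qed

lemma P_operator_imp_prob_space: "P_operator M A \<Longrightarrow> prob_space M"
  by (simp add: P_operator_def)

lemma euclid_prob_profile: "P_operator M A \<Longrightarrow> \<eta> \<in> profile M A k \<Longrightarrow> euclid_prob (2 * k) \<eta>"
  by (auto simp: profile_def joint_distr_eq P_operator_imp_prob_space
      intro!: euclid_prob_distr measurable_profile_vec)

lemma zero_in_Linf_ball: "(\<lambda>_. 0) \<in> Linf_ball M"
  unfolding Linf_ball_def Linf_norm_def by (simp add: esssup_I)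

lemma profile_nonempty: "profile M A k \<noteq> {}"
  using zero_in_Linf_ball by (auto simp: profile_def intro!: exI[of _ "\<lambda>_ _. 0"])

lemma LP_dist_profile_bounds:
  assumes "P_operator M A" "P_operator N B"
  shows "\<forall>\<eta>\<in>profile M A k. \<forall>\<mu>\<in>profile N B k. 0 \<le> LP_dist (2 * k) \<eta> \<mu> \<and> LP_dist (2 * k) \<eta> \<mu> \<le> 1"
  using LP_dist_le_one LP_dist_nonneg euclid_prob_profile[OF assms(1)] euclid_prob_profile[OF assms(2)]
  by simp

text \<open>Together with \<open>hausdorff_profile_le\<close> this is the interface to the metrics:
  from then on tuples of functions are matched up to \<open>LP_close\<close>. The strict bound
  matters because a nearest tuple need not exist.\<close>

lemma hausdorff_profile_less_imp_close:
  assumes "P_operator M A" "P_operator N B"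
    and "hausdorff_dist (LP_dist (2 * k)) (profile M A k) (profile N B k) < \<epsilon>"
  shows "\<forall>i<k. f i \<in> Linf_ball M \<Longrightarrow>
      \<exists>g. (\<forall>i<k. g i \<in> Linf_ball N) \<and> LP_close (2 * k) \<epsilon> (joint_distr M A k f) (joint_distr N B k g)"
    and "\<forall>i<k. g i \<in> Linf_ball N \<Longrightarrow>
      \<exists>f. (\<forall>i<k. f i \<in> Linf_ball M) \<and> LP_close (2 * k) \<epsilon> (joint_distr M A k f) (joint_distr N B k g)"
proof -
  note D = hausdorff_dist_lessD[OF LP_dist_profile_bounds[OF assms(1,2)] profile_nonempty profile_nonempty assms(3)]
  show "\<exists>g. (\<forall>i<k. g i \<in> Linf_ball N) \<and> LP_close (2 * k) \<epsilon> (joint_distr M A k f) (joint_distr N B k g)"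
    if f: "\<forall>i<k. f i \<in> Linf_ball M"
  proof -
    have "joint_distr M A k f \<in> profile M A k" using f by (auto simp: profile_def)
    moreover from D(1)[OF this] obtain g where "\<forall>i<k. g i \<in> Linf_ball N"
      "LP_dist (2 * k) (joint_distr M A k f) (joint_distr N B k g) < \<epsilon>"
      by (auto simp: profile_def)
    moreover from this have "joint_distr N B k g \<in> profile N B k" by (auto simp: profile_def)
    ultimately show ?thesis using LP_dist_lessD euclid_prob_profile assms by metis
  qed
  show "\<exists>f. (\<forall>i<k. f i \<in> Linf_ball M) \<and> LP_close (2 * k) \<epsilon> (joint_distr M A k f) (joint_distr N B k g)"
    if g: "\<forall>i<k. g i \<in> Linf_ball N"
  proof -
    have "joint_distr N B k g \<in> profile N B k" using g by (auto simp: profile_def)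
    moreover from D(2)[OF this] obtain f where "\<forall>i<k. f i \<in> Linf_ball M"
      "LP_dist (2 * k) (joint_distr M A k f) (joint_distr N B k g) < \<epsilon>"
      by (auto simp: profile_def)
    moreover from this have "joint_distr M A k f \<in> profile M A k" by (auto simp: profile_def)
    ultimately show ?thesis using LP_dist_lessD euclid_prob_profile assms by metis
  qed
qed

lemma hausdorff_profile_le:
  assumes "P_operator M A" "P_operator N B" "0 < \<epsilon>"
    and "\<And>f. \<forall>i<k. f i \<in> Linf_ball M \<Longrightarrow>
      \<exists>g. (\<forall>i<k. g i \<in> Linf_ball N) \<and> LP_close (2 * k) \<epsilon> (joint_distr M A k f) (joint_distr N B k g)"
    and "\<And>g. \<forall>i<k. g i \<in> Linf_ball N \<Longrightarrow>
      \<exists>f. (\<forall>i<k. f i \<in> Linf_ball M) \<and> LP_close (2 * k) \<epsilon> (joint_distr M A k f) (joint_distr N B k g)"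
  shows "hausdorff_dist (LP_dist (2 * k)) (profile M A k) (profile N B k) \<le> \<epsilon>"
proof (rule hausdorff_dist_le[OF LP_dist_profile_bounds[OF assms(1,2)] profile_nonempty profile_nonempty])
  show "\<exists>y\<in>profile N B k. LP_dist (2 * k) x y \<le> \<epsilon>" if x: "x \<in> profile M A k" for x
  proof -
    obtain f where f: "\<forall>i<k. f i \<in> Linf_ball M" "x = joint_distr M A k f"
      using x by (auto simp: profile_def)
    obtain g where "\<forall>i<k. g i \<in> Linf_ball N" "LP_close (2 * k) \<epsilon> (joint_distr M A k f) (joint_distr N B k g)"
      using assms(4)[OF f(1)] by auto
    then show ?thesis using LP_dist_le[OF _ \<open>0 < \<epsilon>\<close>] f
      by (intro bexI[of _ "joint_distr N B k g"]) (auto simp: profile_def)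
  qed
  show "\<exists>x\<in>profile M A k. LP_dist (2 * k) x y \<le> \<epsilon>" if y: "y \<in> profile N B k" for y
  proof -
    obtain g where g: "\<forall>i<k. g i \<in> Linf_ball N" "y = joint_distr N B k g"
      using y by (auto simp: profile_def)
    obtain f where "\<forall>i<k. f i \<in> Linf_ball M" "LP_close (2 * k) \<epsilon> (joint_distr M A k f) (joint_distr N B k g)"
      using assms(5)[OF g(1)] by auto
    then show ?thesis using LP_dist_le[OF _ \<open>0 < \<epsilon>\<close>] g
      by (intro bexI[of _ "joint_distr M A k f"]) (auto simp: profile_def)
  qed
qed

text \<open>Every Hausdorff distance lies in [0, 1] and the weights are summable. A single term is
  at most \<open>2 ^ k\<close> times the whole sum; conversely, termwise convergence passes to the
  sum by dominated convergence for series.\<close>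

lemma action_dist_tendsto_0_iff:
  assumes Ms: "\<And>n. P_operator (Ms n) (As n)" and M: "P_operator M A"
  shows "(\<lambda>n. action_dist (Ms n) (As n) M A) \<longlonglongrightarrow> 0 \<longleftrightarrow>
    (\<forall>k\<ge>1. (\<lambda>n. hausdorff_dist (LP_dist (2 * k)) (profile (Ms n) (As n) k) (profile M A k)) \<longlonglongrightarrow> 0)"
proof -
  define h where "h n j = hausdorff_dist (LP_dist (2 * Suc j)) (profile (Ms n) (As n) (Suc j)) (profile M A (Suc j))" for n j
  have h: "0 \<le> h n j" "h n j \<le> 1" for n j
    unfolding h_def
    using hausdorff_dist_nonneg[OF LP_dist_profile_bounds[OF Ms M] profile_nonempty profile_nonempty]
      hausdorff_dist_le_one[OF LP_dist_profile_bounds[OF Ms M] profile_nonempty profile_nonempty]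
    by blast+
  have ad: "action_dist (Ms n) (As n) M A = (\<Sum>j. (1 / 2) ^ Suc j * h n j)" for n
    by (simp add: action_dist_def h_def Let_def)
  have geo: "summable (\<lambda>j. (1 / 2) ^ Suc j :: real)"
    by (simp add: summable_mult)
  have summ: "summable (\<lambda>j. (1 / 2) ^ Suc j * h n j)" for n
    by (rule summable_comparison_test'[OF geo, of 0]) (use h in \<open>auto simp: mult_left_le abs_mult\<close>)
  have "(\<lambda>n. \<Sum>j. (1 / 2) ^ Suc j * h n j) \<longlonglongrightarrow> 0 \<longleftrightarrow> (\<forall>j. (\<lambda>n. h n j) \<longlonglongrightarrow> 0)"
  proof (intro iffI allI)
    fix j assume lim: "(\<lambda>n. \<Sum>j. (1 / 2) ^ Suc j * h n j) \<longlonglongrightarrow> 0"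
    have le: "(1 / 2) ^ Suc j * h n j \<le> (\<Sum>j. (1 / 2) ^ Suc j * h n j)" for n
      using sum_le_suminf[OF summ[of n], of "{j}"] h by simp
    have "(\<lambda>n. 2 ^ Suc j * (\<Sum>j. (1 / 2) ^ Suc j * h n j)) \<longlonglongrightarrow> 2 ^ Suc j * 0"
      by (intro tendsto_intros lim)
    then have upper: "(\<lambda>n. 2 ^ Suc j * (\<Sum>j. (1 / 2) ^ Suc j * h n j)) \<longlonglongrightarrow> 0"
      by simp
    have "h n j \<le> 2 ^ Suc j * (\<Sum>j. (1 / 2) ^ Suc j * h n j)" for n
      using mult_left_mono[OF le[of n], of "2 ^ Suc j"] by (simp add: power_divide)
    with h show "(\<lambda>n. h n j) \<longlonglongrightarrow> 0"
      by (intro tendsto_sandwich[OF _ _ tendsto_const upper] always_eventually) auto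
  next
    assume "\<forall>j. (\<lambda>n. h n j) \<longlonglongrightarrow> 0"
    then have "((\<lambda>n. \<Sum>j. (1 / 2) ^ Suc j * h n j) \<longlonglongrightarrow> (\<Sum>j. (1 / 2) ^ Suc j * 0))"
      by (intro tannerys_theorem[OF _ _ geo, THEN conjunct2, THEN conjunct2]) 
        (use h in \<open>auto intro!: tendsto_intros always_eventually simp: mult_left_le abs_mult\<close>)
    then show "(\<lambda>n. \<Sum>j. (1 / 2) ^ Suc j * h n j) \<longlonglongrightarrow> 0" by simp
  qed
  moreover have Suc_iff: "(\<forall>k\<ge>1. P k) \<longleftrightarrow> (\<forall>j. P (Suc j))" for P
    by (metis Suc_le_D One_nat_def le_add1 plus_1_eq_Suc)
  ultimately show ?thesis unfolding ad Suc_iff by (simp add: h_def)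
qed

section \<open>Uniformly small sets for bounded operators\<close>

lemma Linf_norm_le_iff:
  assumes "f \<in> borel_measurable M"
  shows "Linf_norm M f \<le> ereal K \<longleftrightarrow> (AE x in M. \<bar>f x\<bar> \<le> K)"
proof
  assume le: "Linf_norm M f \<le> ereal K"
  have "AE x in M. ereal \<bar>f x\<bar> \<le> Linf_norm M f"
    unfolding Linf_norm_def by (rule esssup_AE)
  then show "AE x in M. \<bar>f x\<bar> \<le> K"
  proof eventually_elim
    case (elim x)
    then have "ereal \<bar>f x\<bar> \<le> ereal K" using le by (rule order_trans)
    then show ?case by simp
  qed
next
  assume "AE x in M. \<bar>f x\<bar> \<le> K"
  then show "Linf_norm M f \<le> ereal K"
    unfolding Linf_norm_def using assms by (intro esssup_I) auto
qed

lemma Linf_ball_iff: "f \<in> Linf_ball M \<longleftrightarrow> f \<in> borel_measurable M \<and> (AE x in M. \<bar>f x\<bar> \<le> 1)"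
  using Linf_norm_le_iff[of f M 1] by (auto simp: Linf_ball_def one_ereal_def)

lemma LinfI: "f \<in> borel_measurable M \<Longrightarrow> AE x in M. \<bar>f x\<bar> \<le> K \<Longrightarrow> f \<in> Linf M"
  using Linf_norm_le_iff[of f M K] by (auto simp: Linf_def intro: le_less_trans)

lemma Linf_measurable: "f \<in> Linf M \<Longrightarrow> f \<in> borel_measurable M"
  by (simp add: Linf_def)

lemma AE_bound_nonneg:
  assumes "prob_space M" "AE x in M. \<bar>f x :: real\<bar> \<le> K"
  shows "0 \<le> K"
proof -
  interpret prob_space M by fact
  have "AE x in M. 0 \<le> K" using assms(2) by eventually_elim linarith
  then show ?thesis by simp
qed

text \<open>Membership in \<open>Linf\<close> only excludes the value \<infinity>. The value
  -\<infinity> is excluded by total mass 1, since \<open>\<bar>f x\<bar>\<close> cannot have a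
  negative bound almost everywhere.\<close>

lemma Linf_norm_real:
  assumes "prob_space M" "f \<in> Linf M"
  obtains r where "0 \<le> r" "Linf_norm M f = ereal r" "AE x in M. \<bar>f x\<bar> \<le> r"
proof -
  have f: "f \<in> borel_measurable M" "Linf_norm M f < \<infinity>" using assms by (auto simp: Linf_def)
  have "Linf_norm M f \<noteq> -\<infinity>"
  proof
    assume "Linf_norm M f = -\<infinity>"
    then have "AE x in M. \<bar>f x\<bar> \<le> -1" using Linf_norm_le_iff[OF f(1), of "-1"] by simp
    then show False using AE_bound_nonneg[OF assms(1), of f "-1"] by simp
  qed
  then obtain r where r: "Linf_norm M f = ereal r" using f(2) by (cases "Linf_norm M f") auto
  then have *: "AE x in M. \<bar>f x\<bar> \<le> r" using Linf_norm_le_iff[OF f(1), of r] by simp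
  show thesis by (rule that[OF AE_bound_nonneg[OF assms(1) *] r *])
qed

lemma Linf_add: "prob_space M \<Longrightarrow> f \<in> Linf M \<Longrightarrow> g \<in> Linf M \<Longrightarrow> (\<lambda>x. f x + g x) \<in> Linf M"
proof -
  assume M: "prob_space M" and f: "f \<in> Linf M" and g: "g \<in> Linf M"
  obtain r where r: "AE x in M. \<bar>f x\<bar> \<le> r" by (rule Linf_norm_real[OF M f])
  obtain s where s: "AE x in M. \<bar>g x\<bar> \<le> s" by (rule Linf_norm_real[OF M g])
  have "AE x in M. \<bar>f x + g x\<bar> \<le> r + s" using r s by eventually_elim linarith
  then show ?thesis using f g by (intro LinfI) (auto simp: Linf_def)
qed

lemma Linf_cmult: "prob_space M \<Longrightarrow> f \<in> Linf M \<Longrightarrow> (\<lambda>x. c * f x) \<in> Linf M"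
proof -
  assume M: "prob_space M" and f: "f \<in> Linf M"
  obtain r where r: "AE x in M. \<bar>f x\<bar> \<le> r" by (rule Linf_norm_real[OF M f])
  have "AE x in M. \<bar>c * f x\<bar> \<le> \<bar>c\<bar> * r" using r by eventually_elim (simp add: abs_mult mult_left_mono)
  then show ?thesis using f by (intro LinfI) (auto simp: Linf_def)
qed

lemma P_operatorD:
  assumes "P_operator M A"
  shows "f \<in> Linf M \<Longrightarrow> integrable M (A f)"
    and "f \<in> Linf M \<Longrightarrow> g \<in> Linf M \<Longrightarrow> AE x in M. f x = g x \<Longrightarrow> AE x in M. A f x = A g x"
    and "f \<in> Linf M \<Longrightarrow> g \<in> Linf M \<Longrightarrow> AE x in M. A (\<lambda>y. f y + g y) x = A f x + A g x"
    and "f \<in> Linf M \<Longrightarrow> AE x in M. A (\<lambda>y. c * f y) x = c * A f x"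
  using assms by (auto simp: P_operator_def)

lemma P_operator_diff:
  assumes "P_operator M A" "f \<in> Linf M" "g \<in> Linf M"
  shows "AE x in M. A (\<lambda>y. f y - g y) x = A f x - A g x"
proof -
  have g: "(\<lambda>y. - 1 * g y) \<in> Linf M"
    by (rule Linf_cmult[OF P_operator_imp_prob_space[OF assms(1)] assms(3)])
  show ?thesis
    using P_operatorD(3)[OF assms(1,2) g] P_operatorD(4)[OF assms(1,3), of "-1"]
    by eventually_elim simp
qed

lemma inf_1_norm_le:
  assumes "prob_space M"
    and "\<And>v K. v \<in> Linf M \<Longrightarrow> AE x in M. \<bar>v x\<bar> \<le> K \<Longrightarrow> L1_norm M (A v) \<le> C * K"
  shows "inf_1_norm M A \<le> ereal C"
  unfolding inf_1_norm_def
proof (rule SUP_least)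
  fix v assume v: "v \<in> {v \<in> Linf M. Linf_norm M v \<noteq> 0}"
  obtain r where r: "0 \<le> r" "Linf_norm M v = ereal r" "AE x in M. \<bar>v x\<bar> \<le> r"
    using Linf_norm_real[OF assms(1)] v by blast
  then have "0 < r" using v by (auto simp: zero_ereal_def)
  then show "ereal (L1_norm M (A v)) / Linf_norm M v \<le> ereal C"
    using assms(2)[of v r] v r by (simp add: field_simps)
qed

text \<open>Any almost-everywhere bound \<open>K\<close> may replace the essential supremum.
  Functions of norm 0 are left out of the supremum in \<open>inf_1_norm\<close>; for them
  homogeneity and invariance under almost-everywhere equality force \<open>A v\<close> to vanish
  almost everywhere.\<close>

lemma P_operator_bounded:
  assumes A: "P_operator M A"
  obtains C where "0 \<le> C"
    "\<And>v K. v \<in> borel_measurable M \<Longrightarrow> AE x in M. \<bar>v x\<bar> \<le> K \<Longrightarrow> L1_norm M (A v) \<le> C * K"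
proof -
  interpret prob_space M using P_operator_imp_prob_space[OF A] .
  \<comment> \<open>The maximum makes \<open>C\<close> nonnegative outright, so that replacing the
    norm \<open>r\<close> by a larger \<open>K\<close> preserves the bound.\<close>
  define C where "C = max 0 (real_of_ereal (inf_1_norm M A))"
  have "inf_1_norm M A < \<infinity>" using A by (simp add: P_operator_def)
  then have C: "inf_1_norm M A \<le> ereal C"
    by (cases "inf_1_norm M A") (auto simp: C_def)
  have "L1_norm M (A v) \<le> C * K" if v: "v \<in> borel_measurable M" and K: "AE x in M. \<bar>v x\<bar> \<le> K" for v K
  proof -
    have vL: "v \<in> Linf M" using LinfI[OF v K] .
    obtain r where r: "0 \<le> r" "Linf_norm M v = ereal r" "AE x in M. \<bar>v x\<bar> \<le> r"
      using Linf_norm_real[OF prob_space_axioms vL] by blast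
    have "r \<le> K" using Linf_norm_le_iff[OF v, of K] K r by simp
    have "0 \<le> C" by (simp add: C_def)
    show ?thesis
    proof (cases "r = 0")
      case True
      have "AE x in M. v x = 0 * v x" using r(3) True by auto
      then have "AE x in M. A v x = A (\<lambda>y. 0 * v y) x"
        by (intro P_operatorD(2)[OF A] vL Linf_cmult prob_space_axioms)
      moreover have "AE x in M. A (\<lambda>y. 0 * v y) x = 0 * A v x"
        by (rule P_operatorD(4)[OF A vL])
      ultimately have "AE x in M. \<bar>A v x\<bar> = 0" by eventually_elim simp
      then have "L1_norm M (A v) = 0"
        unfolding L1_norm_def by (simp add: integral_eq_zero_AE)
      then show ?thesis using \<open>r \<le> K\<close> True \<open>0 \<le> C\<close> by simp
    next
      case False
      then have "v \<in> {v \<in> Linf M. Linf_norm M v \<noteq> 0}" using vL r by (simp add: zero_ereal_def)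
      then have "ereal (L1_norm M (A v)) / Linf_norm M v \<le> inf_1_norm M A"
        unfolding inf_1_norm_def by (rule SUP_upper)
      also have "\<dots> \<le> ereal C" by (rule C)
      finally have "L1_norm M (A v) \<le> C * r" using r False by (simp add: field_simps)
      also have "\<dots> \<le> C * K" using \<open>r \<le> K\<close> \<open>0 \<le> C\<close> by (rule mult_left_mono)
      finally show ?thesis .
    qed
  qed
  moreover have "0 \<le> C" by (simp add: C_def)
  ultimately show thesis using that by blast
qed

section \<open>Rademacher averages and Khintchine's inequality\<close>

text \<open>The expectation of \<open>F (s + \<Sum> \<plusminus>a)\<close> over independent fair
  signs, conditioning on the first sign. The starting point \<open>s\<close> is the parameter over
  which inductions generalise.\<close>

fun rademacher_avg :: "real list \<Rightarrow> (real \<Rightarrow> real) \<Rightarrow> real \<Rightarrow> real" where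
  "rademacher_avg [] F s = F s"
| "rademacher_avg (a # as) F s = (rademacher_avg as F (s + a) + rademacher_avg as F (s - a)) / 2"

lemma rademacher_avg_mono: "(\<And>x. F x \<le> G x) \<Longrightarrow> rademacher_avg as F s \<le> rademacher_avg as G s"
proof (induction as arbitrary: s)
  case (Cons a as)
  from Cons.IH[OF Cons.prems, of "s + a"] Cons.IH[OF Cons.prems, of "s - a"] show ?case by simp
qed simp

lemma rademacher_avg_linear:
  "rademacher_avg as (\<lambda>x. c * F x + d * G x) s = c * rademacher_avg as F s + d * rademacher_avg as G s"
  by (induction as arbitrary: s) (simp_all add: field_simps)

lemma rademacher_avg_square: "rademacher_avg as (\<lambda>x. x\<^sup>2) s = s\<^sup>2 + (\<Sum>a\<leftarrow>as. a\<^sup>2)"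
  by (induction as arbitrary: s) (simp_all add: power2_eq_square field_simps)

text \<open>Averaging \<open>(s + a) ^ 4\<close> and \<open>(s - a) ^ 4\<close> leaves the even
  terms. The factor 3 is the fourth moment of a standard Gaussian: completing the square in
  \<open>a\<^sup>2 + \<sigma>\<close> needs \<open>3 * a ^ 4\<close> where only \<open>a ^ 4\<close>
  is present, and the difference has the favourable sign.\<close>

lemma rademacher_avg_fourth:
  "rademacher_avg as (\<lambda>x. x ^ 4) s \<le> s ^ 4 + 6 * s\<^sup>2 * (\<Sum>a\<leftarrow>as. a\<^sup>2) + 3 * (\<Sum>a\<leftarrow>as. a\<^sup>2)\<^sup>2"
proof (induction as arbitrary: s)
  case (Cons a as)
  let ?\<sigma> = "\<Sum>a\<leftarrow>as. a\<^sup>2"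
  have "rademacher_avg (a # as) (\<lambda>x. x ^ 4) s \<le>
    (((s + a) ^ 4 + 6 * (s + a)\<^sup>2 * ?\<sigma> + 3 * ?\<sigma>\<^sup>2) + ((s - a) ^ 4 + 6 * (s - a)\<^sup>2 * ?\<sigma> + 3 * ?\<sigma>\<^sup>2)) / 2"
    using Cons.IH[of "s + a"] Cons.IH[of "s - a"] by simp
  also have "\<dots> = s ^ 4 + 6 * s\<^sup>2 * (a\<^sup>2 + ?\<sigma>) + 3 * (a\<^sup>2 + ?\<sigma>)\<^sup>2 - 2 * a ^ 4"
    by (simp add: power2_eq_square power4_eq_xxxx field_simps)
  also have "\<dots> \<le> s ^ 4 + 6 * s\<^sup>2 * (a\<^sup>2 + ?\<sigma>) + 3 * (a\<^sup>2 + ?\<sigma>)\<^sup>2"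
    by simp
  finally show ?case by simp
qed simp

text \<open>A quartic minorant of the absolute value: it bounds a first absolute moment from below
  by second and fourth moments, which can be computed.\<close>

lemma square_minus_fourth_le_abs: "y\<^sup>2 - y ^ 4 / 4 \<le> \<bar>y :: real\<bar>"
proof -
  have pos: "z\<^sup>2 - z ^ 4 / 4 \<le> z" if "0 \<le> z" for z :: real
  proof -
    \<comment> \<open>The claim divided by \<open>z\<close> and multiplied by 4. Up to 2 the cubic
      is \<open>(z - 1)\<^sup>2 * (z + 2)\<close> plus \<open>2 - z\<close>; beyond 2 already
      \<open>z ^ 3 - 4 * z\<close> is nonnegative.\<close>
    have "0 \<le> z ^ 3 - 4 * z + 4"
    proof (cases "z \<le> 2")
      case True
      have "0 \<le> (z - 1)\<^sup>2 * (z + 2)" using that by (intro mult_nonneg_nonneg) auto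
      also have "\<dots> = z ^ 3 - 3 * z + 2" by (simp add: power2_eq_square power3_eq_cube algebra_simps)
      finally show ?thesis using True by linarith
    next
      case False
      then have "0 \<le> z * (z - 2) * (z + 2)" by simp
      also have "\<dots> = z ^ 3 - 4 * z" by (simp add: power3_eq_cube algebra_simps)
      finally show ?thesis by linarith
    qed
    then have "0 \<le> z * (z ^ 3 - 4 * z + 4)" using that by simp
    then show ?thesis by (simp add: power2_eq_square power3_eq_cube power4_eq_xxxx algebra_simps)
  qed
  show ?thesis using pos[of "\<bar>y\<bar>"] by (simp add: power_even_abs)
qed

text \<open>The quartic minorant is applied to \<open>x / \<sigma>\<close>, with \<sigma> the
  Euclidean norm of the coefficients. Its average is at least \<open>\<sigma> * (1 - 3 / 4)\<close>,
  whence the factor 4.\<close>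

lemma khintchine_lower: "sqrt (\<Sum>a\<leftarrow>as. a\<^sup>2) \<le> 4 * rademacher_avg as abs 0"
proof -
  define \<sigma> where "\<sigma> = sqrt (\<Sum>a\<leftarrow>as. a\<^sup>2)"
  have S0: "0 \<le> (\<Sum>a\<leftarrow>as. a\<^sup>2)" by (intro sum_list_nonneg) auto
  show ?thesis
  proof (cases "\<sigma> = 0")
    case True
    have "rademacher_avg as (\<lambda>_. 0) 0 \<le> rademacher_avg as abs 0"
      by (rule rademacher_avg_mono) simp
    moreover have "rademacher_avg as (\<lambda>_. 0) 0 = 0"
      using rademacher_avg_linear[of as 0 abs 0 abs 0] by simp
    ultimately show ?thesis using True by (simp add: \<sigma>_def)
  next
    case False
    then have pos: "0 < \<sigma>" using S0 by (simp add: \<sigma>_def)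
    have sq: "\<sigma>\<^sup>2 = (\<Sum>a\<leftarrow>as. a\<^sup>2)" using S0 by (simp add: \<sigma>_def)
    have "(1 / \<sigma>) * x\<^sup>2 + (- (1 / (4 * \<sigma> ^ 3))) * x ^ 4 \<le> \<bar>x\<bar>" for x
    proof -
      have "\<sigma> * ((x / \<sigma>)\<^sup>2 - (x / \<sigma>) ^ 4 / 4) \<le> \<sigma> * \<bar>x / \<sigma>\<bar>"
        using pos by (intro mult_left_mono square_minus_fourth_le_abs) simp
      moreover have "\<sigma> * ((x / \<sigma>)\<^sup>2 - (x / \<sigma>) ^ 4 / 4) = (1 / \<sigma>) * x\<^sup>2 + (- (1 / (4 * \<sigma> ^ 3))) * x ^ 4"
        using pos by (simp add: power_divide power2_eq_square power3_eq_cube power4_eq_xxxx field_simps)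
      moreover have "\<sigma> * \<bar>x / \<sigma>\<bar> = \<bar>x\<bar>" using pos by (simp add: abs_divide)
      ultimately show ?thesis by simp
    qed
    then have "rademacher_avg as (\<lambda>x. (1 / \<sigma>) * x\<^sup>2 + (- (1 / (4 * \<sigma> ^ 3))) * x ^ 4) 0 \<le> rademacher_avg as abs 0"
      by (rule rademacher_avg_mono)
    then have "(1 / \<sigma>) * \<sigma>\<^sup>2 - (1 / (4 * \<sigma> ^ 3)) * rademacher_avg as (\<lambda>x. x ^ 4) 0 \<le> rademacher_avg as abs 0"
      unfolding rademacher_avg_linear rademacher_avg_square by (simp add: sq)
    moreover have "(1 / (4 * \<sigma> ^ 3)) * rademacher_avg as (\<lambda>x. x ^ 4) 0 \<le> (1 / (4 * \<sigma> ^ 3)) * (3 * (\<sigma>\<^sup>2)\<^sup>2)"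
      using rademacher_avg_fourth[of as 0] pos by (intro mult_left_mono) (auto simp: sq)
    moreover have "(1 / \<sigma>) * \<sigma>\<^sup>2 - (1 / (4 * \<sigma> ^ 3)) * (3 * (\<sigma>\<^sup>2)\<^sup>2) = \<sigma> / 4"
      using pos by (simp add: power2_eq_square power3_eq_cube field_simps)
    ultimately have "\<sigma> / 4 \<le> rademacher_avg as abs 0" by linarith
    then show ?thesis by (simp add: \<sigma>_def)
  qed
qed

lemma sum_abs_le_rademacher_avg:
  "(\<Sum>a\<leftarrow>as. \<bar>a\<bar>) \<le> 4 * sqrt (real (length as)) * rademacher_avg as abs 0"
proof -
  have "(\<Sum>a\<leftarrow>as. \<bar>a\<bar>)\<^sup>2 \<le> real (length as) * (\<Sum>a\<leftarrow>as. a\<^sup>2)"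
    using sum_squared_le_sum_of_squares[of "\<lambda>i. \<bar>as ! i\<bar>" "{0..<length as}"]
    by (simp add: sum_list_sum_nth mult.commute)
  then have "(\<Sum>a\<leftarrow>as. \<bar>a\<bar>) \<le> sqrt (real (length as) * (\<Sum>a\<leftarrow>as. a\<^sup>2))"
    by (rule real_le_rsqrt)
  also have "\<dots> \<le> sqrt (real (length as)) * (4 * rademacher_avg as abs 0)"
    unfolding real_sqrt_mult by (intro mult_left_mono khintchine_lower) simp
  finally show ?thesis by (simp add: mult_ac)
qed

lemma measurable_rademacher_avg:
  assumes "\<And>h. h \<in> set hs \<Longrightarrow> A h \<in> borel_measurable M" "g \<in> borel_measurable M"
  shows "(\<lambda>x. rademacher_avg (map (\<lambda>h. A h x) hs) abs (g x)) \<in> borel_measurable M"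
  using assms
proof (induction hs arbitrary: g)
  case (Cons h hs)
  have [measurable]: "A h \<in> borel_measurable M" "g \<in> borel_measurable M" using Cons.prems by auto
  have [measurable]: "(\<lambda>x. rademacher_avg (map (\<lambda>h. A h x) hs) abs (g x + A h x)) \<in> borel_measurable M"
    "(\<lambda>x. rademacher_avg (map (\<lambda>h. A h x) hs) abs (g x - A h x)) \<in> borel_measurable M"
    using Cons.prems by (auto intro!: Cons.IH)
  show ?case by simp
qed auto

text \<open>For every choice of signs the signed sum of the functions is bounded by
  \<open>K\<close>, so its image has norm at most \<open>C * K\<close>, and the average inherits
  this. The function \<open>w\<close> accumulates the signs already chosen.\<close>

lemma integral_rademacher_avg_le:
  assumes A: "P_operator M A"
    and C: "\<And>v K. v \<in> borel_measurable M \<Longrightarrow> AE x in M. \<bar>v x\<bar> \<le> K \<Longrightarrow> L1_norm M (A v) \<le> C * K"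
    and "set hs \<subseteq> Linf M" "w \<in> Linf M"
    and "AE x in M. \<bar>w x\<bar> + (\<Sum>h\<leftarrow>hs. \<bar>h x\<bar>) \<le> K"
  shows "integrable M (\<lambda>x. rademacher_avg (map (\<lambda>h. A h x) hs) abs (A w x)) \<and>
    (\<integral>x. rademacher_avg (map (\<lambda>h. A h x) hs) abs (A w x) \<partial>M) \<le> C * K"
  using assms(3-)
proof (induction hs arbitrary: w)
  case Nil
  then have "AE x in M. \<bar>w x\<bar> \<le> K" by simp
  then show ?case
    using C[of w K] P_operatorD(1)[OF A, of w] Nil by (simp add: L1_norm_def Linf_measurable)
next
  case (Cons h hs)
  have M: "prob_space M" using P_operator_imp_prob_space[OF A] .
  have h: "h \<in> Linf M" and hs: "set hs \<subseteq> Linf M" and w: "w \<in> Linf M" using Cons.prems by auto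
  have mh: "A h \<in> borel_measurable M" and mw: "A w \<in> borel_measurable M"
    and mhs: "\<And>h. h \<in> set hs \<Longrightarrow> A h \<in> borel_measurable M"
    using P_operatorD(1)[OF A] h w hs by auto
  have wp: "(\<lambda>x. w x + h x) \<in> Linf M" by (rule Linf_add[OF M w h])
  have wm: "(\<lambda>x. w x - h x) \<in> Linf M"
    using Linf_add[OF M w Linf_cmult[OF M h, of "-1"]] by simp
  \<comment> \<open>\<open>P\<close> and \<open>Q\<close> come from the recursion and contain
    \<open>A w \<plusminus> A h\<close>; \<open>P'\<close> and \<open>Q'\<close> fit the induction
    hypothesis and contain \<open>A (w \<plusminus> h)\<close>. Linearity of \<open>A\<close>
    identifies them only almost everywhere.\<close>
  define P where "P = (\<lambda>x. rademacher_avg (map (\<lambda>h. A h x) hs) abs (A w x + A h x))"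
  define Q where "Q = (\<lambda>x. rademacher_avg (map (\<lambda>h. A h x) hs) abs (A w x - A h x))"
  define P' where "P' = (\<lambda>x. rademacher_avg (map (\<lambda>h. A h x) hs) abs (A (\<lambda>x. w x + h x) x))"
  define Q' where "Q' = (\<lambda>x. rademacher_avg (map (\<lambda>h. A h x) hs) abs (A (\<lambda>x. w x - h x) x))"
  have meas: "P \<in> borel_measurable M" "Q \<in> borel_measurable M" "P' \<in> borel_measurable M" "Q' \<in> borel_measurable M"
    unfolding P_def Q_def P'_def Q'_def
    using mh mw mhs P_operatorD(1)[OF A wp] P_operatorD(1)[OF A wm]
    by (auto intro!: measurable_rademacher_avg)
  have PP: "AE x in M. P x = P' x"
    using P_operatorD(3)[OF A w h] by eventually_elim (simp add: P_def P'_def)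
  have QQ: "AE x in M. Q x = Q' x"
    using P_operator_diff[OF A w h] by eventually_elim (simp add: Q_def Q'_def)
  have "integrable M P' \<and> integral\<^sup>L M P' \<le> C * K"
    unfolding P'_def
  proof (rule Cons.IH[OF hs wp])
    show "AE x in M. \<bar>w x + h x\<bar> + (\<Sum>h\<leftarrow>hs. \<bar>h x\<bar>) \<le> K"
      using Cons.prems(3) by eventually_elim simp
  qed
  moreover have "integrable M Q' \<and> integral\<^sup>L M Q' \<le> C * K"
    unfolding Q'_def
  proof (rule Cons.IH[OF hs wm])
    show "AE x in M. \<bar>w x - h x\<bar> + (\<Sum>h\<leftarrow>hs. \<bar>h x\<bar>) \<le> K"
      using Cons.prems(3) by eventually_elim simp
  qed
  ultimately have "integrable M P \<and> integral\<^sup>L M P \<le> C * K" "integrable M Q \<and> integral\<^sup>L M Q \<le> C * K"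
    using integrable_cong_AE[OF meas(1,3) PP] integral_cong_AE[OF meas(1,3) PP]
      integrable_cong_AE[OF meas(2,4) QQ] integral_cong_AE[OF meas(2,4) QQ] by auto
  moreover have "(\<lambda>x. rademacher_avg (map (\<lambda>h. A h x) (h # hs)) abs (A w x)) = (\<lambda>x. (P x + Q x) / 2)"
    by (simp add: P_def Q_def)
  ultimately show ?case by (auto simp: add_divide_distrib)
qed

text \<open>The cotype 2 estimate: the pointwise inequality for the numbers \<open>A h x\<close> is
  integrated, and the average on its right is controlled through the signed sums. Bounding each term
  separately would give growth linear in \<open>length hs\<close> in place of the square
  root.\<close>

lemma sum_L1_norm_le:
  assumes A: "P_operator M A"
    and C: "\<And>v K. v \<in> borel_measurable M \<Longrightarrow> AE x in M. \<bar>v x\<bar> \<le> K \<Longrightarrow> L1_norm M (A v) \<le> C * K"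
    and hs: "set hs \<subseteq> Linf M"
    and K: "AE x in M. (\<Sum>h\<leftarrow>hs. \<bar>h x\<bar>) \<le> K"
  shows "(\<Sum>h\<leftarrow>hs. L1_norm M (A h)) \<le> 4 * sqrt (real (length hs)) * (C * K)"
proof -
  have zero: "(\<lambda>_. 0) \<in> Linf M" using zero_in_Linf_ball Linf_ball_subset_Linf by blast
  have "AE x in M. A (\<lambda>_. 0) x = 0" using P_operatorD(4)[OF A zero, of 0] by simp
  define R where "R = (\<lambda>x. rademacher_avg (map (\<lambda>h. A h x) hs) abs (A (\<lambda>_. 0) x))"
  have R: "integrable M R" "integral\<^sup>L M R \<le> C * K"
    using integral_rademacher_avg_le[OF A C hs zero, of K] K by (auto simp: R_def)
  have int: "h \<in> set hs \<Longrightarrow> integrable M (\<lambda>x. \<bar>A h x\<bar>)" for h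
    using P_operatorD(1)[OF A] hs by auto
  have sum_int: "set hs' \<subseteq> set hs \<Longrightarrow> integrable M (\<lambda>x. \<Sum>h\<leftarrow>hs'. \<bar>A h x\<bar>) \<and>
      (\<Sum>h\<leftarrow>hs'. L1_norm M (A h)) = (\<integral>x. (\<Sum>h\<leftarrow>hs'. \<bar>A h x\<bar>) \<partial>M)" for hs'
    by (induction hs') (auto simp: L1_norm_def int)
  have "(\<Sum>h\<leftarrow>hs. L1_norm M (A h)) = (\<integral>x. (\<Sum>h\<leftarrow>hs. \<bar>A h x\<bar>) \<partial>M)" using sum_int by blast
  also have "\<dots> \<le> (\<integral>x. 4 * sqrt (real (length hs)) * R x \<partial>M)"
  proof (rule integral_mono_AE)
    show "AE x in M. (\<Sum>h\<leftarrow>hs. \<bar>A h x\<bar>) \<le> 4 * sqrt (real (length hs)) * R x"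
      using \<open>AE x in M. A (\<lambda>_. 0) x = 0\<close>
    proof eventually_elim
      case (elim x)
      then show ?case
        using sum_abs_le_rademacher_avg[of "map (\<lambda>h. A h x) hs"] by (simp add: R_def o_def)
    qed
  qed (use sum_int R in auto)
  also have "\<dots> = 4 * sqrt (real (length hs)) * integral\<^sup>L M R" by simp
  also have "\<dots> \<le> 4 * sqrt (real (length hs)) * (C * K)"
    using R by (intro mult_left_mono) auto
  finally show ?thesis .
qed

section \<open>Sets on which an operator is small\<close>

text \<open>All functions below the indicator are tested, not just the indicator: overwriting
  \<open>f\<close> by a constant on \<open>S\<close> changes it by an arbitrary bounded function
  supported there.\<close>

definition small_on :: "'a measure \<Rightarrow> 'a operator \<Rightarrow> 'a set \<Rightarrow> real \<Rightarrow> bool" where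
  "small_on M A S \<delta> \<longleftrightarrow>
     (\<forall>h \<in> borel_measurable M. (AE x in M. \<bar>h x\<bar> \<le> indicator S x) \<longrightarrow> L1_norm M (A h) \<le> \<delta>)"

lemma small_on_subset:
  assumes "small_on M A S \<delta>" "T \<subseteq> S"
  shows "small_on M A T \<delta>"
  unfolding small_on_def
proof (intro ballI impI)
  fix h :: "'a \<Rightarrow> real" assume h: "h \<in> borel_measurable M" "AE x in M. \<bar>h x\<bar> \<le> indicator T x"
  have "AE x in M. \<bar>h x\<bar> \<le> indicator S x"
    using h(2)
  proof eventually_elim
    case (elim x)
    then show ?case using assms(2) by (auto simp: indicator_def of_bool_def split: if_splits)
  qed
  then show "L1_norm M (A h) \<le> \<delta>" using assms h by (simp add: small_on_def)
qed

text \<open>Otherwise each \<open>S i\<close> supports an \<open>h i\<close> whose image has norm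
  above \<delta>. By disjointness the absolute values of \<open>N\<close> of them still sum to at
  most 1, so \<open>N * \<delta> \<le> 4 * C * sqrt N\<close>, which fails for large
  \<open>N\<close>.\<close>

lemma disjoint_family_small_on:
  fixes S :: "nat \<Rightarrow> 'a set"
  assumes A: "P_operator M A" and disj: "disjoint_family S" and "0 < \<delta>"
  shows "\<exists>i. small_on M A (S i) \<delta>"
proof (rule ccontr)
  assume "\<not> ?thesis"
  then have "\<forall>i. \<exists>h. h \<in> borel_measurable M \<and> (AE x in M. \<bar>h x\<bar> \<le> indicator (S i) x) \<and> \<delta> < L1_norm M (A h)"
    by (auto simp: small_on_def not_le)
  then obtain h where h: "\<And>i. h i \<in> borel_measurable M"
      "\<And>i. AE x in M. \<bar>h i x\<bar> \<le> indicator (S i) x" "\<And>i. \<delta> < L1_norm M (A (h i))"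
    by metis
  obtain C where C: "0 \<le> C"
    "\<And>v K. v \<in> borel_measurable M \<Longrightarrow> AE x in M. \<bar>v x\<bar> \<le> K \<Longrightarrow> L1_norm M (A v) \<le> C * K"
    using P_operator_bounded[OF A] by blast
  obtain N :: nat where N: "(4 * C / \<delta>)\<^sup>2 < real N" using reals_Archimedean2 by blast
  then have "0 < N" by (smt (verit) of_nat_0 zero_le_power2 gr0I)
  define hs where "hs = map h [0..<N]"
  have "AE x in M. \<forall>i\<in>{0..<N}. \<bar>h i x\<bar> \<le> indicator (S i) x"
    by (rule AE_finite_allI) (use h in auto)
  then have sum1: "AE x in M. (\<Sum>h\<leftarrow>hs. \<bar>h x\<bar>) \<le> 1"
  proof eventually_elim
    case (elim x)
    have "(\<Sum>h\<leftarrow>hs. \<bar>h x\<bar>) = (\<Sum>i\<in>{0..<N}. \<bar>h i x\<bar>)"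
      by (simp add: hs_def o_def interv_sum_list_conv_sum_set_nat)
    also have "\<dots> \<le> (\<Sum>i\<in>{0..<N}. indicator (S i) x)"
      by (rule sum_mono) (use elim in auto)
    also have "\<dots> = indicator (\<Union>i\<in>{0..<N}. S i) x"
      by (rule indicator_UN_disjoint[symmetric]) (use disj in \<open>auto simp: disjoint_family_on_def\<close>)
    also have "\<dots> \<le> 1" by (simp add: indicator_def)
    finally show ?case .
  qed
  have hsL: "set hs \<subseteq> Linf M"
  proof -
    have "AE x in M. \<bar>h i x\<bar> \<le> 1" for i
      using h(2)[of i] by eventually_elim (auto simp: indicator_def of_bool_def split: if_splits)
    then show ?thesis using h(1) by (auto simp: hs_def intro!: LinfI)
  qed
  have "real N * \<delta> = (\<Sum>i\<in>{0..<N}. \<delta>)" by simp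
  also have "\<dots> \<le> (\<Sum>i\<in>{0..<N}. L1_norm M (A (h i)))" by (rule sum_mono) (use h(3) in \<open>auto intro: less_imp_le\<close>)
  also have "\<dots> = (\<Sum>h\<leftarrow>hs. L1_norm M (A h))"
    by (simp add: hs_def o_def interv_sum_list_conv_sum_set_nat)
  also have "\<dots> \<le> 4 * sqrt (real N) * (C * 1)"
    using sum_L1_norm_le[OF A C(2) hsL sum1] by (simp add: hs_def)
  finally have "real N * \<delta> \<le> sqrt (real N) * (4 * C)" by simp
  moreover have "sqrt (real N) * (sqrt (real N) * \<delta>) = real N * \<delta>"
    by (simp flip: mult.assoc)
  ultimately have "sqrt (real N) * (sqrt (real N) * \<delta>) \<le> sqrt (real N) * (4 * C)" by linarith
  then have "sqrt (real N) * \<delta> \<le> 4 * C"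
    by (rule mult_left_le_imp_le) (use \<open>0 < N\<close> in simp)
  then have "sqrt (real N) \<le> 4 * C / \<delta>"
    using \<open>0 < \<delta>\<close> by (simp add: field_simps)
  then have "real N \<le> (4 * C / \<delta>)\<^sup>2"
    using sqrt_le_D by blast
  then show False using N by linarith
qed

lemma infinite_subfamily_small_on:
  fixes S :: "nat \<Rightarrow> 'a set"
  assumes A: "P_operator M A" and disj: "disjoint_family S" and "0 < \<delta>" and I: "infinite I"
  shows "\<exists>J\<subseteq>I. infinite J \<and> small_on M A (\<Union>i\<in>J. S i) \<delta>"
proof -
  \<comment> \<open>The pairing function arranges the enumeration of \<open>I\<close> as an infinite
    matrix, of which \<open>J p\<close> is row \<open>p\<close>.\<close>
  define J where "J p = range (\<lambda>q. enumerate I (prod_encode (p, q)))" for p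
  have inj: "inj (\<lambda>q. enumerate I (prod_encode (p, q)))" for p
    by (auto intro!: injI dest!: injD[OF inj_enumerate[OF I]] simp: prod_encode_eq)
  have disjJ: "J p \<inter> J p' = {}" if "p \<noteq> p'" for p p'
    using that by (auto simp: J_def prod_encode_eq dest!: injD[OF inj_enumerate[OF I]])
  have "disjoint_family (\<lambda>p. \<Union>i\<in>J p. S i)"
    unfolding disjoint_family_on_def
  proof (intro ballI impI)
    fix p p' :: nat assume "p \<noteq> p'"
    then have "S i \<inter> S i' = {}" if "i \<in> J p" "i' \<in> J p'" for i i'
      using that disjJ[of p p'] disjoint_family_onD[OF disj, of i i'] by auto
    then show "(\<Union>i\<in>J p. S i) \<inter> (\<Union>i\<in>J p'. S i) = {}" by blast
  qed
  from disjoint_family_small_on[OF A this \<open>0 < \<delta>\<close>] obtain p where "small_on M A (\<Union>i\<in>J p. S i) \<delta>" ..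
  moreover have "infinite (J p)" unfolding J_def by (rule range_inj_infinite[OF inj])
  moreover have "J p \<subseteq> I" using enumerate_in_set[OF I] by (auto simp: J_def)
  ultimately show ?thesis by blast
qed

lemma ex_decseq_small_on:
  fixes S :: "nat \<Rightarrow> 'a set"
  assumes A: "P_operator M A" and disj: "disjoint_family S"
    and S: "\<And>i. S i \<in> sets M" "\<And>i. 0 < measure M (S i)"
  obtains R where "\<And>j. R j \<in> sets M" "\<And>j. 0 < measure M (R j)" "decseq R"
    "(\<lambda>j. measure M (R j)) \<longlonglongrightarrow> 0" "\<And>j. small_on M A (R j) (1 / real (Suc j))"
proof -
  interpret prob_space M using P_operator_imp_prob_space[OF A] .
  have "\<exists>J. \<forall>n. (infinite (J n) \<and> small_on M A (\<Union>i\<in>J n. S i) (1 / real (Suc n))) \<and> J (Suc n) \<subseteq> J n"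
  proof (rule dependent_nat_choice)
    show "\<exists>J. infinite J \<and> small_on M A (\<Union>i\<in>J. S i) (1 / real (Suc 0))"
      using infinite_subfamily_small_on[OF A disj, of "1 / real (Suc 0)" UNIV] by auto
  next
    fix J n assume "infinite J \<and> small_on M A (\<Union>i\<in>J. S i) (1 / real (Suc n))"
    then show "\<exists>J'. (infinite J' \<and> small_on M A (\<Union>i\<in>J'. S i) (1 / real (Suc (Suc n)))) \<and> J' \<subseteq> J"
      using infinite_subfamily_small_on[OF A disj, of "1 / real (Suc (Suc n))" J] by auto
  qed
  then obtain J where J: "\<And>n. infinite (J n)" "\<And>n. small_on M A (\<Union>i\<in>J n. S i) (1 / real (Suc n))"
      "\<And>n. J (Suc n) \<subseteq> J n" by blast
  have Jdec: "decseq J" using J(3) by (auto simp: decseq_Suc_iff)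
  \<comment> \<open>Dropping the indices below \<open>n\<close> makes the intersection of all
    \<open>R n\<close> empty, since a point lies in at most one \<open>S i\<close>; continuity from
    above then sends the measures to 0. As \<open>J n\<close> is infinite, \<open>R n\<close> still
    contains some \<open>S i\<close> and keeps positive measure.\<close>
  define R where "R n = (\<Union>i\<in>J n \<inter> {n..}. S i)" for n
  have Rs: "R n \<in> sets M" for n using S by (auto simp: R_def)
  have pos: "0 < measure M (R n)" for n
  proof -
    obtain i where "i \<in> J n" "n \<le> i" using J(1)[of n] by (meson infinite_nat_iff_unbounded_le)
    then have "S i \<subseteq> R n" by (auto simp: R_def)
    then have "measure M (S i) \<le> measure M (R n)" using Rs by (intro finite_measure_mono)
    then show ?thesis using S(2)[of i] by linarith
  qed
  have dec: "decseq R"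
    unfolding decseq_def R_def using Jdec by (fastforce simp: decseq_def)
  have lim: "(\<lambda>n. measure M (R n)) \<longlonglongrightarrow> measure M (\<Inter>n. R n)"
    by (rule finite_Lim_measure_decseq) (use Rs dec in auto)
  have "(\<Inter>n. R n) = {}"
  proof (rule ccontr)
    assume "(\<Inter>n. R n) \<noteq> {}"
    then obtain x where x: "\<And>n. x \<in> R n" by auto
    obtain i where "x \<in> S i" using x[of 0] by (auto simp: R_def)
    moreover obtain i' where "i' \<ge> Suc i" "x \<in> S i'" using x[of "Suc i"] by (auto simp: R_def)
    ultimately show False using disjoint_family_onD[OF disj, of i i'] by auto
  qed
  moreover have "small_on M A (R n) (1 / real (Suc n))" for n
    by (rule small_on_subset[OF J(2)]) (auto simp: R_def)
  ultimately show thesis using lim by (intro that[of R] Rs pos dec) simp_all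
qed

text \<open>Large finite families need not extend one another, so an infinite one has to be
  extracted. A set is \<open>rich\<close> if arbitrarily large disjoint families have all their
  members meet it in positive measure. By pigeonhole, when a rich set is cut in two, one part is
  rich; pieces of positive measure can thus be split off forever.\<close>

lemma ex_infinite_disjoint_family:
  assumes "prob_space M"
    and many: "\<And>m. \<exists>\<E>. finite \<E> \<and> m \<le> card \<E> \<and> disjoint \<E> \<and> \<E> \<subseteq> sets M \<and> (\<forall>E\<in>\<E>. 0 < measure M E)"
  obtains S :: "nat \<Rightarrow> 'a set" where "disjoint_family S" "\<And>i. S i \<in> sets M" "\<And>i. 0 < measure M (S i)"
proof -
  interpret prob_space M by fact
  define rich where "rich B \<longleftrightarrow> B \<in> sets M \<and>
    (\<forall>m. \<exists>\<E>. finite \<E> \<and> m \<le> card \<E> \<and> disjoint \<E> \<and> \<E> \<subseteq> sets M \<and> (\<forall>E\<in>\<E>. 0 < measure M (E \<inter> B)))" for B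
  have rich_space: "rich (space M)"
    unfolding rich_def
  proof (intro conjI allI)
    fix m
    obtain \<E> where E: "finite \<E>" "m \<le> card \<E>" "disjoint \<E>" "\<E> \<subseteq> sets M" "\<forall>E\<in>\<E>. 0 < measure M E"
      using many by blast
    have "E \<inter> space M = E" if "E \<in> \<E>" for E using E(4) that sets.sets_into_space by auto
    then show "\<exists>\<E>. finite \<E> \<and> m \<le> card \<E> \<and> disjoint \<E> \<and> \<E> \<subseteq> sets M \<and> (\<forall>E\<in>\<E>. 0 < measure M (E \<inter> space M))"
      using E by (intro exI[of _ \<E>]) auto
  qed simp
  have rich_Un: "rich B1 \<or> rich B2" if B: "rich (B1 \<union> B2)" "B1 \<in> sets M" "B2 \<in> sets M" for B1 B2
  proof (rule ccontr)
    assume "\<not> ?thesis"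
    then obtain m1 m2 where
      m1: "\<And>\<E>. finite \<E> \<Longrightarrow> m1 \<le> card \<E> \<Longrightarrow> disjoint \<E> \<Longrightarrow> \<E> \<subseteq> sets M \<Longrightarrow> \<exists>E\<in>\<E>. \<not> 0 < measure M (E \<inter> B1)" and
      m2: "\<And>\<E>. finite \<E> \<Longrightarrow> m2 \<le> card \<E> \<Longrightarrow> disjoint \<E> \<Longrightarrow> \<E> \<subseteq> sets M \<Longrightarrow> \<exists>E\<in>\<E>. \<not> 0 < measure M (E \<inter> B2)"
      using B unfolding rich_def by metis
    obtain \<E> where E: "finite \<E>" "m1 + m2 \<le> card \<E>" "disjoint \<E>" "\<E> \<subseteq> sets M"
        "\<forall>E\<in>\<E>. 0 < measure M (E \<inter> (B1 \<union> B2))"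
      using B(1) unfolding rich_def by blast
    define \<E>1 where "\<E>1 = {E \<in> \<E>. 0 < measure M (E \<inter> B1)}"
    define \<E>2 where "\<E>2 = {E \<in> \<E>. 0 < measure M (E \<inter> B2)}"
    have "\<E> \<subseteq> \<E>1 \<union> \<E>2"
    proof
      fix E assume "E \<in> \<E>"
      then have "0 < measure M ((E \<inter> B1) \<union> (E \<inter> B2))" using E(5) by (simp add: Int_Un_distrib)
      also have "\<dots> \<le> measure M (E \<inter> B1) + measure M (E \<inter> B2)"
        using \<open>E \<in> \<E>\<close> E(4) B by (intro measure_Un_le) auto
      finally have "0 < measure M (E \<inter> B1) \<or> 0 < measure M (E \<inter> B2)" by linarith
      then show "E \<in> \<E>1 \<union> \<E>2" using \<open>E \<in> \<E>\<close> by (auto simp: \<E>1_def \<E>2_def)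
    qed
    then have "card \<E> \<le> card (\<E>1 \<union> \<E>2)"
      using E(1) by (intro card_mono) (auto simp: \<E>1_def \<E>2_def)
    also have "\<dots> \<le> card \<E>1 + card \<E>2" by (rule card_Un_le)
    finally have "m1 \<le> card \<E>1 \<or> m2 \<le> card \<E>2" using E(2) by linarith
    moreover have "disjoint \<E>1" "disjoint \<E>2" using E(3) by (auto simp: \<E>1_def \<E>2_def disjoint_def)
    ultimately show False
      using m1[of \<E>1] m2[of \<E>2] E(1,4) by (auto simp: \<E>1_def \<E>2_def)
  qed
  have split: "\<exists>B'. rich B' \<and> B' \<subseteq> B \<and> 0 < measure M (B - B')" if B: "rich B" for B
  proof -
    \<comment> \<open>Two members suffice: cutting \<open>B\<close> along \<open>E0\<close> leaves
      positive measure on both sides, because \<open>E1\<close> lies outside \<open>E0\<close>. A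
      rich side is kept and the other is split off.\<close>
    obtain \<E> where E: "finite \<E>" "2 \<le> card \<E>" "disjoint \<E>" "\<E> \<subseteq> sets M" "\<forall>E\<in>\<E>. 0 < measure M (E \<inter> B)"
      using B unfolding rich_def by blast
    obtain E0 E1 where E01: "E0 \<in> \<E>" "E1 \<in> \<E>" "E0 \<noteq> E1"
      using E(2) by (metis card_le_Suc0_iff_eq[OF E(1)] not_less_eq_eq numeral_2_eq_2)
    then have "E0 \<inter> E1 = {}" using E(3) by (auto simp: disjoint_def)
    have sets: "B \<in> sets M" "E0 \<in> sets M" "E1 \<in> sets M" using B E01 E(4) by (auto simp: rich_def)
    have "rich ((E0 \<inter> B) \<union> (B - E0))" using B by (simp add: Un_Diff_Int Int_commute Un_commute)
    then have "rich (E0 \<inter> B) \<or> rich (B - E0)" using sets by (intro rich_Un) auto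
    then show ?thesis
    proof
      assume r: "rich (E0 \<inter> B)"
      have "0 < measure M (E1 \<inter> B)" using E01 E(5) by simp
      also have "\<dots> \<le> measure M (B - E0 \<inter> B)"
        using sets \<open>E0 \<inter> E1 = {}\<close> by (intro finite_measure_mono) auto
      finally show ?thesis using r by (intro exI[of _ "E0 \<inter> B"]) auto
    next
      assume r: "rich (B - E0)"
      have "0 < measure M (E0 \<inter> B)" using E01 E(5) by simp
      moreover have "B - (B - E0) = E0 \<inter> B" by auto
      ultimately show ?thesis using r by (intro exI[of _ "B - E0"]) auto
    qed
  qed
  have "\<exists>B. \<forall>n. rich (B n) \<and> (B (Suc n) \<subseteq> B n \<and> 0 < measure M (B n - B (Suc n)))"
    by (rule dependent_nat_choice) (use rich_space split in auto)
  then obtain B where B: "\<And>n. rich (B n)" "\<And>n. B (Suc n) \<subseteq> B n" "\<And>n. 0 < measure M (B n - B (Suc n))"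
    by blast
  have "decseq B" using B(2) by (auto simp: decseq_Suc_iff)
  have "disjoint_family (\<lambda>n. B n - B (Suc n))"
    unfolding disjoint_family_on_def
  proof (intro ballI impI)
    fix m n :: nat assume "m \<noteq> n"
    then have "Suc m \<le> n \<or> Suc n \<le> m" by auto
    then have "B n \<subseteq> B (Suc m) \<or> B m \<subseteq> B (Suc n)" using \<open>decseq B\<close> by (auto dest: decseqD)
    then show "(B m - B (Suc m)) \<inter> (B n - B (Suc n)) = {}" by auto
  qed
  moreover have "B n - B (Suc n) \<in> sets M" for n using B(1) by (auto simp: rich_def)
  ultimately show thesis using that B(3) by blast
qed

section \<open>Integration against an ultrafilter\<close>

context
  fixes M :: "'a measure" and \<U> :: "'a set set"
  assumes prob: "prob_space M" and uf: "measure_ultrafilter M \<U>"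
begin

interpretation prob_space M by (rule prob)

section \<open>Membership in an ultrafilter\<close>

lemma uf_filter: "measure_filter M \<U>"
  using uf by (simp add: measure_ultrafilter_def)

lemma uf_sets: "S \<in> \<U> \<Longrightarrow> S \<in> sets M"
  using uf_filter by (auto simp: measure_filter_def)

lemma uf_pos: "S \<in> \<U> \<Longrightarrow> 0 < measure M S"
  using uf_filter by (auto simp: measure_filter_def)

lemma uf_Int: "S \<in> \<U> \<Longrightarrow> T \<in> \<U> \<Longrightarrow> S \<inter> T \<in> \<U>"
  using uf_filter by (auto simp: measure_filter_def)

lemma uf_mono: "S \<in> \<U> \<Longrightarrow> T \<in> sets M \<Longrightarrow> S \<subseteq> T \<Longrightarrow> T \<in> \<U>"
  using uf_filter by (auto simp: measure_filter_def)

lemma uf_nonempty: "S \<in> \<U> \<Longrightarrow> S \<noteq> {}"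
  using uf_pos by fastforce

lemma uf_space: "space M \<in> \<U>"
proof -
  obtain S where "S \<in> \<U>" using uf_filter by (auto simp: measure_filter_def)
  then show ?thesis using uf_mono uf_sets sets.sets_into_space by blast
qed

text \<open>\<open>E\<close> and \<U> together generate a filter, whose members have positive
  measure because all the traces \<open>S \<inter> E\<close> do; maximality then puts
  \<open>E\<close> into \<U>.\<close>

lemma uf_maximal:
  assumes E: "E \<in> sets M" and meets: "\<And>S. S \<in> \<U> \<Longrightarrow> 0 < measure M (S \<inter> E)"
  shows "E \<in> \<U>"
proof -
  define \<F> where "\<F> = {T \<in> sets M. \<exists>S\<in>\<U>. S \<inter> E \<subseteq> T}"
  have "measure_filter M \<F>"
    unfolding measure_filter_def
  proof (intro conjI ballI impI)
    show "\<F> \<noteq> {}" using E uf_space by (auto simp: \<F>_def)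
    show "\<F> \<subseteq> sets M" by (auto simp: \<F>_def)
    show "0 < measure M T" if T: "T \<in> \<F>" for T
    proof -
      obtain S where S: "S \<in> \<U>" "S \<inter> E \<subseteq> T" "T \<in> sets M" using T by (auto simp: \<F>_def)
      then show ?thesis using meets[OF S(1)] finite_measure_mono[OF S(2,3)] by linarith
    qed
    show "T \<inter> T' \<in> \<F>" if "T \<in> \<F>" "T' \<in> \<F>" for T T'
    proof -
      obtain S S' where "S \<in> \<U>" "S \<inter> E \<subseteq> T" "S' \<in> \<U>" "S' \<inter> E \<subseteq> T'"
        using \<open>T \<in> \<F>\<close> \<open>T' \<in> \<F>\<close> by (auto simp: \<F>_def)
      then have "S \<inter> S' \<in> \<U>" "(S \<inter> S') \<inter> E \<subseteq> T \<inter> T'" using uf_Int by auto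
      then show ?thesis using that by (auto simp: \<F>_def)
    qed
    show "T' \<in> \<F>" if "T \<in> \<F>" "T' \<in> sets M" "T \<subseteq> T'" for T T'
      using that by (auto simp: \<F>_def)
  qed
  moreover have "\<U> \<subseteq> \<F>" using uf_sets by (auto simp: \<F>_def)
  ultimately have "\<F> = \<U>" using uf by (simp add: measure_ultrafilter_def)
  moreover have "E \<in> \<F>" using E uf_space by (auto simp: \<F>_def)
  ultimately show ?thesis by simp
qed

text \<open>This is what makes integration against \<U> insensitive to null sets.\<close>

lemma uf_AE:
  assumes "AE x in M. P x" and [measurable]: "{x \<in> space M. P x} \<in> sets M"
  shows "{x \<in> space M. P x} \<in> \<U>"
proof (rule uf_maximal)
  fix S assume S: "S \<in> \<U>"
  then have [measurable]: "S \<in> sets M" by (rule uf_sets)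
  have "AE x in M. x \<in> S \<longleftrightarrow> x \<in> S \<inter> {x \<in> space M. P x}"
    using assms(1) AE_space by eventually_elim auto
  then have "measure M S = measure M (S \<inter> {x \<in> space M. P x})"
    by (rule finite_measure_eq_AE) auto
  then show "0 < measure M (S \<inter> {x \<in> space M. P x})" using uf_pos[OF S] by simp
qed fact

text \<open>If neither set belonged to \<U>, some member \<open>S\<close> would be null outside
  \<open>E\<close> and some member \<open>T\<close> null inside it, so that
  \<open>S \<inter> T\<close> would be null.\<close>

lemma uf_compl:
  assumes E: "E \<in> sets M" and "E \<notin> \<U>"
  shows "space M - E \<in> \<U>"
proof (rule ccontr)
  assume "space M - E \<notin> \<U>"
  then obtain S where S: "S \<in> \<U>" "\<not> 0 < measure M (S \<inter> (space M - E))"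
    using uf_maximal[of "space M - E"] E by auto
  obtain T where T: "T \<in> \<U>" "\<not> 0 < measure M (T \<inter> E)" using uf_maximal[OF E] assms by auto
  have sets: "S \<in> sets M" "T \<in> sets M" using S T uf_sets by auto
  have "measure M (S \<inter> T) \<le> measure M ((S \<inter> (space M - E)) \<union> (T \<inter> E))"
    using sets E sets.sets_into_space[OF sets(1)] by (intro finite_measure_mono) auto
  also have "\<dots> \<le> measure M (S \<inter> (space M - E)) + measure M (T \<inter> E)"
    using sets E by (intro measure_Un_le) auto
  finally show False using uf_pos[OF uf_Int[OF S(1) T(1)]] S T by linarith
qed

text \<open>Convergence along \<U>. The integral against the 0-1 valued charge of \<U> is this
  limit, and its properties are derived from it instead of from approximation by simple
  functions.\<close>

definition uf_limit :: "('a \<Rightarrow> real) \<Rightarrow> real \<Rightarrow> bool" where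
  "uf_limit f c \<longleftrightarrow> (\<forall>\<epsilon>>0. {x \<in> space M. \<bar>f x - c\<bar> < \<epsilon>} \<in> \<U>)"

lemma uf_limitD: "uf_limit f c \<Longrightarrow> 0 < \<epsilon> \<Longrightarrow> {x \<in> space M. \<bar>f x - c\<bar> < \<epsilon>} \<in> \<U>"
  by (simp add: uf_limit_def)

lemma ex_uf_limit:
  assumes "f \<in> Linf M"
  obtains c where "uf_limit f c"
proof -
  have [measurable]: "f \<in> borel_measurable M" using assms by (rule Linf_measurable)
  obtain r where r: "AE x in M. \<bar>f x\<bar> \<le> r" by (rule Linf_norm_real[OF prob assms])
  \<comment> \<open>The limit will be the supremum of the levels that \<open>f\<close> reaches on a
    member of \<U>.\<close>
  define T where "T = {t. {x \<in> space M. t \<le> f x} \<in> \<U>}"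
  have "{x \<in> space M. - r \<le> f x} \<in> \<U>"
    by (rule uf_AE) (use r in \<open>eventually_elim, auto\<close>, measurable)
  then have ne: "T \<noteq> {}" by (auto simp: T_def)
  have below: "{x \<in> space M. f x \<le> r} \<in> \<U>"
    by (rule uf_AE) (use r in \<open>eventually_elim, auto\<close>, measurable)
  have bdd: "bdd_above T"
  proof (rule bdd_aboveI[of _ r])
    fix t assume "t \<in> T"
    then have "{x \<in> space M. t \<le> f x} \<inter> {x \<in> space M. f x \<le> r} \<noteq> {}"
      using uf_nonempty[OF uf_Int[OF _ below]] by (auto simp: T_def)
    then show "t \<le> r" by auto
  qed
  have "uf_limit f (Sup T)"
    unfolding uf_limit_def
  proof (intro allI impI)
    fix \<epsilon> :: real assume "0 < \<epsilon>"
    then obtain t where t: "t \<in> T" "Sup T - \<epsilon> < t"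
      using less_cSup_iff[OF ne bdd, of "Sup T - \<epsilon>"] by auto
    have "Sup T + \<epsilon> / 2 \<notin> T"
      using cSup_upper[OF _ bdd, of "Sup T + \<epsilon> / 2"] \<open>0 < \<epsilon>\<close> by auto
    then have "space M - {x \<in> space M. Sup T + \<epsilon> / 2 \<le> f x} \<in> \<U>"
      by (intro uf_compl) (auto simp: T_def)
    moreover have "{x \<in> space M. t \<le> f x} \<in> \<U>" using t by (simp add: T_def)
    ultimately have "{x \<in> space M. t \<le> f x} \<inter> (space M - {x \<in> space M. Sup T + \<epsilon> / 2 \<le> f x}) \<in> \<U>"
      by (intro uf_Int)
    then show "{x \<in> space M. \<bar>f x - Sup T\<bar> < \<epsilon>} \<in> \<U>"
      by (rule uf_mono) (use t \<open>0 < \<epsilon>\<close> in auto)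
  qed
  then show thesis by (rule that)
qed

lemma uf_limit_close:
  assumes "uf_limit f c" "uf_limit g d" and S: "S \<in> \<U>" "\<And>x. x \<in> S \<Longrightarrow> \<bar>f x - g x\<bar> \<le> \<epsilon>"
  shows "\<bar>c - d\<bar> \<le> \<epsilon>"
proof (rule field_le_epsilon)
  fix \<delta> :: real assume "0 < \<delta>"
  then have "{x \<in> space M. \<bar>f x - c\<bar> < \<delta> / 2} \<inter> {x \<in> space M. \<bar>g x - d\<bar> < \<delta> / 2} \<inter> S \<in> \<U>"
    by (intro uf_Int uf_limitD[OF assms(1)] uf_limitD[OF assms(2)] S(1)) simp_all
  then obtain x where "\<bar>f x - c\<bar> < \<delta> / 2" "\<bar>g x - d\<bar> < \<delta> / 2" "x \<in> S"
    using uf_nonempty by fastforce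
  then show "\<bar>c - d\<bar> \<le> \<epsilon> + \<delta>" using S(2)[of x] by linarith
qed

lemma uf_limitI:
  assumes "S \<in> \<U>" "\<And>x. x \<in> S \<Longrightarrow> f x = c" "f \<in> borel_measurable M"
  shows "uf_limit f c"
  unfolding uf_limit_def
proof (intro allI impI)
  fix \<epsilon> :: real assume "0 < \<epsilon>"
  show "{x \<in> space M. \<bar>f x - c\<bar> < \<epsilon>} \<in> \<U>"
    using assms \<open>0 < \<epsilon>\<close> sets.sets_into_space[OF uf_sets[OF assms(1)]]
    by (intro uf_mono[OF assms(1)]) auto
qed

text \<open>For each \<open>i\<close> either \<open>E i\<close> or its complement is in \<U>; on the
  intersection of these finitely many members the simple function is constant.\<close>

lemma uf_limit_simple:
  fixes \<alpha> :: "nat \<Rightarrow> real"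
  assumes E: "\<And>i. E i \<in> sets M"
  shows "uf_limit (\<lambda>x. \<Sum>i = 1..n. \<alpha> i * indicator (E i) x) (\<Sum>i = 1..n. \<alpha> i * (if E i \<in> \<U> then 1 else 0))"
proof -
  define S where "S i = (if E i \<in> \<U> then E i else space M - E i)" for i
  have S: "S i \<in> \<U>" for i using uf_compl[OF E] by (auto simp: S_def)
  have fin: "space M \<inter> (\<Inter>i\<in>{1..n}. S i) \<in> \<U>"
  proof (induction n)
    case (Suc n)
    have "space M \<inter> (\<Inter>i\<in>{1..Suc n}. S i) = (space M \<inter> (\<Inter>i\<in>{1..n}. S i)) \<inter> S (Suc n)"
      by (auto simp: atLeastAtMostSuc_conv)
    then show ?case using uf_Int[OF Suc S] by simp
  qed (simp add: uf_space)
  show ?thesis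
  proof (rule uf_limitI[OF fin])
    fix x assume x: "x \<in> space M \<inter> (\<Inter>i\<in>{1..n}. S i)"
    show "(\<Sum>i = 1..n. \<alpha> i * indicator (E i) x) = (\<Sum>i = 1..n. \<alpha> i * (if E i \<in> \<U> then 1 else 0))"
    proof (rule sum.cong)
      fix i assume "i \<in> {1..n}"
      then have "x \<in> S i" using x by auto
      then show "\<alpha> i * indicator (E i) x = \<alpha> i * (if E i \<in> \<U> then 1 else 0)"
        by (auto simp: S_def split: if_splits)
    qed simp
  qed (use E in measurable)
qed

text \<open>Independence of the approximating sequence, hence uniqueness in the description that
  defines \<open>uf_integral\<close>.\<close>

lemma uf_limit_approx:
  fixes \<alpha> :: "nat \<Rightarrow> nat \<Rightarrow> real"
  assumes f: "f \<in> borel_measurable M" and E: "\<And>n i. E n i \<in> sets M"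
    and lim: "(\<lambda>n. Linf_norm M (\<lambda>x. f x - (\<Sum>i = 1..n. \<alpha> n i * indicator (E n i) x))) \<longlonglongrightarrow> 0"
    and c: "uf_limit f c"
  shows "(\<lambda>n. \<Sum>i = 1..n. \<alpha> n i * (if E n i \<in> \<U> then 1 else 0)) \<longlonglongrightarrow> c"
proof (rule tendstoI)
  fix \<epsilon> :: real assume "0 < \<epsilon>"
  note [measurable] = f E
  have "\<forall>\<^sub>F n in sequentially. Linf_norm M (\<lambda>x. f x - (\<Sum>i = 1..n. \<alpha> n i * indicator (E n i) x)) < ereal (\<epsilon> / 2)"
    using order_tendstoD(2)[OF lim, of "ereal (\<epsilon> / 2)"] \<open>0 < \<epsilon>\<close> by (simp add: zero_ereal_def)
  then show "\<forall>\<^sub>F n in sequentially. dist (\<Sum>i = 1..n. \<alpha> n i * (if E n i \<in> \<U> then 1 else 0)) c < \<epsilon>"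
  proof eventually_elim
    case (elim n)
    let ?s = "\<lambda>x. \<Sum>i = 1..n. \<alpha> n i * indicator (E n i) x"
    have "AE x in M. \<bar>f x - ?s x\<bar> \<le> \<epsilon> / 2"
    proof (rule iffD1[OF Linf_norm_le_iff])
      show "(\<lambda>x. f x - ?s x) \<in> borel_measurable M" by measurable
    qed (rule less_imp_le[OF elim])
    then have "{x \<in> space M. \<bar>f x - ?s x\<bar> \<le> \<epsilon> / 2} \<in> \<U>"
      by (rule uf_AE) measurable
    moreover have "uf_limit ?s (\<Sum>i = 1..n. \<alpha> n i * (if E n i \<in> \<U> then 1 else 0))"
      by (rule uf_limit_simple[OF E])
    ultimately have "\<bar>c - (\<Sum>i = 1..n. \<alpha> n i * (if E n i \<in> \<U> then 1 else 0))\<bar> \<le> \<epsilon> / 2"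
      using uf_limit_close[OF c] by blast
    then show ?case using \<open>0 < \<epsilon>\<close> by (simp add: dist_real_def abs_minus_commute)
  qed
qed

text \<open>The existence half for \<open>uf_integral\<close>, whose definition asks for sums of
  exactly \<open>n\<close> terms at stage \<open>n\<close>: the range is cut into \<open>n\<close>
  intervals of length \<open>2 * R / n\<close>.\<close>

lemma ex_simple_approx:
  assumes "f \<in> Linf M"
  shows "\<exists>(\<alpha> :: nat \<Rightarrow> nat \<Rightarrow> real) E. (\<forall>n i. E n i \<in> sets M) \<and>
    (\<lambda>n. Linf_norm M (\<lambda>x. f x - (\<Sum>i = 1..n. \<alpha> n i * indicator (E n i) x))) \<longlonglongrightarrow> 0"
proof -
  have [measurable]: "f \<in> borel_measurable M" using assms by (rule Linf_measurable)
  obtain r where "0 \<le> r" and r: "AE x in M. \<bar>f x\<bar> \<le> r" using Linf_norm_real[OF prob assms] by blast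
  \<comment> \<open>Strictly above \<open>r\<close>, so that \<open>f < R\<close> almost everywhere
    and no value falls into a cell numbered \<open>n + 1\<close>; also positive when
    \<open>r = 0\<close>.\<close>
  define R where "R = r + 1"
  have R: "0 < R" "r < R" using \<open>0 \<le> r\<close> by (auto simp: R_def)
  \<comment> \<open>Cells are numbered from 1 while the floor starts at 0, hence the
    \<open>- 1\<close>; \<open>\<alpha> n i\<close> is the left endpoint of cell \<open>i\<close>.
    For \<open>n = 0\<close> the sum is empty, and the error bound is claimed only for
    \<open>0 < n\<close>.\<close>
  define E where "E n i = {x \<in> space M. \<lfloor>(f x + R) * real n / (2 * R)\<rfloor> = int i - 1}" for n i
  define \<alpha> where "\<alpha> n i = - R + 2 * R * (real i - 1) / real n" for n i
  have E[measurable]: "E n i \<in> sets M" for n i unfolding E_def by measurable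
  define s where "s n x = (\<Sum>i = 1..n. \<alpha> n i * indicator (E n i) x)" for n x
  have [measurable]: "s n \<in> borel_measurable M" for n unfolding s_def by measurable
  have bound: "Linf_norm M (\<lambda>x. f x - s n x) \<le> ereal (2 * R / real n)" if "0 < n" for n
  proof -
    have "AE x in M. \<bar>f x - s n x\<bar> \<le> 2 * R / real n"
      using r AE_space
    proof eventually_elim
      case (elim x)
      define y where "y = (f x + R) * real n / (2 * R)"
      have "0 \<le> y" using elim R by (auto simp: y_def)
      have "y < real n" using elim R \<open>0 < n\<close> by (auto simp: y_def field_simps)
      define i where "i = nat \<lfloor>y\<rfloor> + 1"
      have i: "int i = \<lfloor>y\<rfloor> + 1" using \<open>0 \<le> y\<close> by (simp add: i_def)
      have "i \<in> {1..n}" using \<open>y < real n\<close> \<open>0 \<le> y\<close> by (simp add: i_def) linarith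
      have "s n x = (\<Sum>j = 1..n. if j = i then \<alpha> n j else 0)"
        unfolding s_def by (rule sum.cong) (use elim i in \<open>auto simp: E_def indicator_def y_def\<close>)
      also have "\<dots> = \<alpha> n i" using \<open>i \<in> {1..n}\<close> by simp
      also have "\<dots> = - R + 2 * R * real_of_int \<lfloor>y\<rfloor> / real n"
        using arg_cong[OF i, of real_of_int] by (simp add: \<alpha>_def)
      finally have sx: "s n x = - R + 2 * R * real_of_int \<lfloor>y\<rfloor> / real n" .
      have fx: "f x = - R + 2 * R * y / real n" using \<open>0 < n\<close> R by (simp add: y_def)
      have "f x - s n x = 2 * R / real n * (y - real_of_int \<lfloor>y\<rfloor>)"
        unfolding fx sx by (simp add: right_diff_distrib diff_divide_distrib)
      moreover have "\<bar>y - real_of_int \<lfloor>y\<rfloor>\<bar> \<le> 1" by linarith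
      ultimately show ?case
        using R \<open>0 < n\<close> mult_left_le[of "\<bar>y - real_of_int \<lfloor>y\<rfloor>\<bar>" "2 * R / real n"] by (simp only: abs_mult) simp
    qed
    then show ?thesis by (subst Linf_norm_le_iff) auto
  qed
  have "(\<lambda>n. Linf_norm M (\<lambda>x. f x - s n x)) \<longlonglongrightarrow> 0"
  proof (rule tendsto_sandwich)
    have "0 \<le> Linf_norm M (\<lambda>x. f x - s n x)" if "0 < n" for n
    proof -
      have "(\<lambda>x. f x - s n x) \<in> Linf M"
        using bound[OF that] by (auto simp: Linf_def intro: le_less_trans)
      then obtain q where "0 \<le> q" "Linf_norm M (\<lambda>x. f x - s n x) = ereal q"
        using Linf_norm_real[OF prob] by blast
      then show ?thesis by simp
    qed
    then show "\<forall>\<^sub>F n in sequentially. 0 \<le> Linf_norm M (\<lambda>x. f x - s n x)"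
      by (intro eventually_sequentiallyI[of 1]) auto
    show "\<forall>\<^sub>F n in sequentially. Linf_norm M (\<lambda>x. f x - s n x) \<le> ereal (2 * R / real n)"
      using bound by (intro eventually_sequentiallyI[of 1]) auto
    have "(\<lambda>n. 2 * R / real n) \<longlonglongrightarrow> 0" by (rule lim_const_over_n)
    then show "(\<lambda>n. ereal (2 * R / real n)) \<longlonglongrightarrow> 0" by (simp add: zero_ereal_def)
  qed simp
  then show ?thesis using E unfolding s_def by blast
qed

lemma uf_integral_eq:
  assumes f: "f \<in> Linf M" and c: "uf_limit f c"
  shows "uf_integral M \<U> f = c"
  unfolding uf_integral_def
proof (rule the_equality)
  note m = Linf_measurable[OF f]
  obtain \<alpha> :: "nat \<Rightarrow> nat \<Rightarrow> real" and E where
    "\<And>n i. E n i \<in> sets M" "(\<lambda>n. Linf_norm M (\<lambda>x. f x - (\<Sum>i = 1..n. \<alpha> n i * indicator (E n i) x))) \<longlonglongrightarrow> 0"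
    using ex_simple_approx[OF f] by blast
  with uf_limit_approx[OF m this c] show "\<exists>(\<alpha> :: nat \<Rightarrow> nat \<Rightarrow> real) E.
      (\<forall>n i. E n i \<in> sets M) \<and>
      (\<lambda>n. Linf_norm M (\<lambda>x. f x - (\<Sum>i = 1..n. \<alpha> n i * indicator (E n i) x))) \<longlonglongrightarrow> 0 \<and>
      (\<lambda>n. \<Sum>i = 1..n. \<alpha> n i * (if E n i \<in> \<U> then 1 else 0)) \<longlonglongrightarrow> c"
    by blast
next
  fix d assume "\<exists>(\<alpha> :: nat \<Rightarrow> nat \<Rightarrow> real) E.
      (\<forall>n i. E n i \<in> sets M) \<and>
      (\<lambda>n. Linf_norm M (\<lambda>x. f x - (\<Sum>i = 1..n. \<alpha> n i * indicator (E n i) x))) \<longlonglongrightarrow> 0 \<and>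
      (\<lambda>n. \<Sum>i = 1..n. \<alpha> n i * (if E n i \<in> \<U> then 1 else 0)) \<longlonglongrightarrow> d"
  then obtain \<alpha> :: "nat \<Rightarrow> nat \<Rightarrow> real" and E where E: "\<And>n i. E n i \<in> sets M"
    and "(\<lambda>n. Linf_norm M (\<lambda>x. f x - (\<Sum>i = 1..n. \<alpha> n i * indicator (E n i) x))) \<longlonglongrightarrow> 0"
    and d: "(\<lambda>n. \<Sum>i = 1..n. \<alpha> n i * (if E n i \<in> \<U> then 1 else 0)) \<longlonglongrightarrow> d" by blast
  then have "(\<lambda>n. \<Sum>i = 1..n. \<alpha> n i * (if E n i \<in> \<U> then 1 else 0)) \<longlonglongrightarrow> c"
    using uf_limit_approx[OF Linf_measurable[OF f] _ _ c] by blast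
  with d show "d = c" by (rule LIMSEQ_unique)
qed

lemma uf_limit_uf_integral: "f \<in> Linf M \<Longrightarrow> uf_limit f (uf_integral M \<U> f)"
  using ex_uf_limit uf_integral_eq by metis

lemma uf_integral_add:
  assumes f: "f \<in> Linf M" and g: "g \<in> Linf M"
  shows "uf_integral M \<U> (\<lambda>x. f x + g x) = uf_integral M \<U> f + uf_integral M \<U> g"
proof (rule uf_integral_eq[OF Linf_add[OF prob f g]], unfold uf_limit_def, intro allI impI)
  fix \<epsilon> :: real assume "0 < \<epsilon>"
  have [measurable]: "f \<in> borel_measurable M" "g \<in> borel_measurable M" using f g by (auto simp: Linf_def)
  let ?c = "uf_integral M \<U> f" and ?d = "uf_integral M \<U> g"
  have "{x \<in> space M. \<bar>f x - ?c\<bar> < \<epsilon> / 2} \<inter> {x \<in> space M. \<bar>g x - ?d\<bar> < \<epsilon> / 2} \<in> \<U>"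
    using \<open>0 < \<epsilon>\<close>
    by (intro uf_Int uf_limitD[OF uf_limit_uf_integral[OF f]] uf_limitD[OF uf_limit_uf_integral[OF g]]) simp_all
  then show "{x \<in> space M. \<bar>f x + g x - (?c + ?d)\<bar> < \<epsilon>} \<in> \<U>"
  proof (rule uf_mono)
    have "\<bar>f x + g x - (?c + ?d)\<bar> < \<epsilon>" if "\<bar>f x - ?c\<bar> < \<epsilon> / 2" "\<bar>g x - ?d\<bar> < \<epsilon> / 2" for x
      using that by linarith
    then show "{x \<in> space M. \<bar>f x - ?c\<bar> < \<epsilon> / 2} \<inter> {x \<in> space M. \<bar>g x - ?d\<bar> < \<epsilon> / 2}
        \<subseteq> {x \<in> space M. \<bar>f x + g x - (?c + ?d)\<bar> < \<epsilon>}" by blast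
  qed measurable
qed

lemma uf_integral_cmult:
  assumes f: "f \<in> Linf M"
  shows "uf_integral M \<U> (\<lambda>x. a * f x) = a * uf_integral M \<U> f"
proof (rule uf_integral_eq[OF Linf_cmult[OF prob f]], unfold uf_limit_def, intro allI impI)
  fix \<epsilon> :: real assume "0 < \<epsilon>"
  have [measurable]: "f \<in> borel_measurable M" using f by (auto simp: Linf_def)
  let ?c = "uf_integral M \<U> f"
  have pos: "0 < \<epsilon> / (\<bar>a\<bar> + 1)" using \<open>0 < \<epsilon>\<close> by (simp add: add_nonneg_pos)
  have "{x \<in> space M. \<bar>f x - ?c\<bar> < \<epsilon> / (\<bar>a\<bar> + 1)} \<in> \<U>"
    using uf_limit_uf_integral[OF f] pos by (auto simp: uf_limit_def)
  then show "{x \<in> space M. \<bar>a * f x - a * ?c\<bar> < \<epsilon>} \<in> \<U>"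
  proof (rule uf_mono)
    show "{x \<in> space M. \<bar>f x - ?c\<bar> < \<epsilon> / (\<bar>a\<bar> + 1)} \<subseteq> {x \<in> space M. \<bar>a * f x - a * ?c\<bar> < \<epsilon>}"
    proof safe
      fix x assume "\<bar>f x - ?c\<bar> < \<epsilon> / (\<bar>a\<bar> + 1)"
      then have "(\<bar>a\<bar> + 1) * \<bar>f x - ?c\<bar> < \<epsilon>" by (simp add: pos_less_divide_eq add_nonneg_pos mult.commute)
      moreover have "\<bar>a * f x - a * ?c\<bar> = \<bar>a\<bar> * \<bar>f x - ?c\<bar>" by (simp add: right_diff_distrib flip: abs_mult)
      ultimately show "\<bar>a * f x - a * ?c\<bar> < \<epsilon>" by (simp add: algebra_simps)
    qed
  qed measurable
qed

lemma uf_integral_close: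
  assumes f: "f \<in> Linf M" and g: "g \<in> Linf M" and "AE x in M. \<bar>f x - g x\<bar> \<le> K"
  shows "\<bar>uf_integral M \<U> f - uf_integral M \<U> g\<bar> \<le> K"
proof -
  have [measurable]: "f \<in> borel_measurable M" "g \<in> borel_measurable M" using f g by (auto simp: Linf_def)
  have "{x \<in> space M. \<bar>f x - g x\<bar> \<le> K} \<in> \<U>" by (rule uf_AE[OF assms(3)]) measurable
  then show ?thesis
    by (rule uf_limit_close[OF uf_limit_uf_integral[OF f] uf_limit_uf_integral[OF g]]) simp
qed

lemma uf_integral_cong_AE:
  assumes "f \<in> Linf M" "g \<in> Linf M" "AE x in M. f x = g x"
  shows "uf_integral M \<U> f = uf_integral M \<U> g"
  using uf_integral_close[OF assms(1,2), of 0] assms(3) by simp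

lemma uf_integral_abs_le:
  assumes "f \<in> Linf M" "AE x in M. \<bar>f x\<bar> \<le> K"
  shows "\<bar>uf_integral M \<U> f\<bar> \<le> K"
proof -
  have z: "(\<lambda>_. 0) \<in> Linf M" using zero_in_Linf_ball Linf_ball_subset_Linf by blast
  have "uf_integral M \<U> (\<lambda>_. 0) = 0"
    using uf_integral_cmult[OF z, of 0] by simp
  then show ?thesis using uf_integral_close[OF assms(1) z, of K] assms(2) by simp
qed

text \<open>The values on one member of \<U>, however small its measure, determine the integral;
  this is the freedom that overwriting exploits.\<close>

lemma uf_integral_const_on:
  assumes "f \<in> Linf M" "S \<in> \<U>" "\<And>x. x \<in> S \<Longrightarrow> f x = c"
  shows "uf_integral M \<U> f = c"
  using assms by (intro uf_integral_eq uf_limitI[of S]) (auto simp: Linf_def)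

end

text \<open>The scalar \<open>\<psi> g\<close> enters as a constant function, of norm
  \<open>\<bar>\<psi> g\<bar>\<close> on a probability space, so the operator norm grows by at most
  1. Keeping \<psi> abstract covers both signs of the ultrafilter integral.\<close>

lemma P_operator_add_functional:
  assumes A: "P_operator M A"
    and cong: "\<And>f g. f \<in> Linf M \<Longrightarrow> g \<in> Linf M \<Longrightarrow> AE x in M. f x = g x \<Longrightarrow> \<psi> f = \<psi> g"
    and add: "\<And>f g. f \<in> Linf M \<Longrightarrow> g \<in> Linf M \<Longrightarrow> \<psi> (\<lambda>x. f x + g x) = \<psi> f + \<psi> g"
    and cmult: "\<And>c f. f \<in> Linf M \<Longrightarrow> \<psi> (\<lambda>x. c * f x) = c * \<psi> f"
    and bound: "\<And>f K. f \<in> Linf M \<Longrightarrow> AE x in M. \<bar>f x\<bar> \<le> K \<Longrightarrow> \<bar>\<psi> f\<bar> \<le> K"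
  shows "P_operator M (\<lambda>g \<omega>. A g \<omega> + \<psi> g)"
proof -
  interpret prob_space M using P_operator_imp_prob_space[OF A] .
  obtain C where C: "0 \<le> C"
    "\<And>v K. v \<in> borel_measurable M \<Longrightarrow> AE x in M. \<bar>v x\<bar> \<le> K \<Longrightarrow> L1_norm M (A v) \<le> C * K"
    using P_operator_bounded[OF A] by blast
  have "inf_1_norm M (\<lambda>g \<omega>. A g \<omega> + \<psi> g) \<le> ereal (C + 1)"
  proof (rule inf_1_norm_le[OF prob_space_axioms])
    fix v K assume v: "v \<in> Linf M" and K: "AE x in M. \<bar>v x\<bar> \<le> K"
    have int: "integrable M (A v)" by (rule P_operatorD(1)[OF A v])
    have "L1_norm M (\<lambda>\<omega>. A v \<omega> + \<psi> v) \<le> (\<integral>\<omega>. \<bar>A v \<omega>\<bar> + \<bar>\<psi> v\<bar> \<partial>M)"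
      unfolding L1_norm_def using int by (intro integral_mono) auto
    also have "\<dots> = L1_norm M (A v) + \<bar>\<psi> v\<bar>"
      unfolding L1_norm_def using int by (simp add: prob_space)
    also have "\<dots> \<le> C * K + K"
      using C(2)[OF Linf_measurable[OF v] K] bound[OF v K] by (rule add_mono)
    finally show "L1_norm M (\<lambda>\<omega>. A v \<omega> + \<psi> v) \<le> (C + 1) * K" by (simp add: algebra_simps)
  qed
  then have "inf_1_norm M (\<lambda>g \<omega>. A g \<omega> + \<psi> g) < \<infinity>" by (auto intro: le_less_trans)
  moreover have "AE x in M. A f x + \<psi> f = A g x + \<psi> g"
    if "f \<in> Linf M" "g \<in> Linf M" "AE x in M. f x = g x" for f g
    using P_operatorD(2)[OF A that] cong[OF that] by simp
  moreover have "AE x in M. A (\<lambda>y. f y + g y) x + \<psi> (\<lambda>y. f y + g y) = A f x + \<psi> f + (A g x + \<psi> g)"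
    if "f \<in> Linf M" "g \<in> Linf M" for f g
    using P_operatorD(3)[OF A that] by eventually_elim (simp add: add[OF that])
  moreover have "AE x in M. A (\<lambda>y. c * f y) x + \<psi> (\<lambda>y. c * f y) = c * (A f x + \<psi> f)"
    if "f \<in> Linf M" for c f
    using P_operatorD(4)[OF A that, of c] by eventually_elim (simp add: cmult[OF that, of c] distrib_left)
  ultimately show ?thesis
    unfolding P_operator_def using P_operatorD(1)[OF A] prob_space_axioms by auto
qed

section \<open>Cones over graphs\<close>

lemma AE_uniform_count_measure:
  "finite V \<Longrightarrow> (AE x in uniform_count_measure V. P x) \<longleftrightarrow> (\<forall>x\<in>V. P x)"
  unfolding uniform_count_measure_def AE_point_measure by (auto simp: card_gt_0_iff)

lemma borel_measurable_uniform_count_measure: "f \<in> borel_measurable (uniform_count_measure V)"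
  by (simp add: uniform_count_measure_def)

lemma Linf_ball_uniform_count_measure:
  "finite V \<Longrightarrow> f \<in> Linf_ball (uniform_count_measure V) \<longleftrightarrow> (\<forall>x\<in>V. \<bar>f x\<bar> \<le> 1)"
  by (simp add: Linf_ball_iff AE_uniform_count_measure borel_measurable_uniform_count_measure)

lemma P_operator_adj_operator:
  fixes G :: "'a graph"
  assumes G: "finite_simple_graph G"
  shows "P_operator (uniform_count_measure (verts G)) (adj_operator G)"
proof -
  let ?V = "verts G"
  let ?M = "uniform_count_measure ?V"
  have fin: "finite ?V" "?V \<noteq> {}" using G by (auto simp: finite_simple_graph_def)
  have M: "prob_space ?M" by (rule prob_space_uniform_count_measure[OF fin])
  have "inf_1_norm ?M (adj_operator G) \<le> ereal (real (card ?V))"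
  proof (rule inf_1_norm_le[OF M])
    fix v :: "'a \<Rightarrow> real" and K assume "AE x in ?M. \<bar>v x\<bar> \<le> K"
    then have v: "\<And>x. x \<in> ?V \<Longrightarrow> \<bar>v x\<bar> \<le> K" using fin by (simp add: AE_uniform_count_measure)
    have adj: "\<bar>adj_operator G v x\<bar> \<le> real (card ?V) * K" for x
    proof -
      have "\<bar>adj_operator G v x\<bar> \<le> (\<Sum>y\<in>{y \<in> ?V. {x, y} \<in> edges G}. \<bar>v y\<bar>)"
        unfolding adj_operator_def by (rule sum_abs)
      also have "\<dots> \<le> (\<Sum>y\<in>?V. \<bar>v y\<bar>)"
        using fin by (intro sum_mono2) auto
      also have "\<dots> \<le> real (card ?V) * K"
        using v by (rule sum_bounded_above)
      finally show ?thesis .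
    qed
    have "(\<Sum>x\<in>?V. \<bar>adj_operator G v x\<bar>) \<le> real (card ?V) * (real (card ?V) * K)"
      using adj by (intro sum_bounded_above)
    then show "L1_norm ?M (adj_operator G v) \<le> real (card ?V) * K"
      using fin by (simp add: L1_norm_def integral_uniform_count_measure divide_le_eq mult.commute card_gt_0_iff)
  qed
  then have "inf_1_norm ?M (adj_operator G) < \<infinity>" by (auto intro: le_less_trans)
  moreover have "integrable ?M (adj_operator G f)" for f
    unfolding uniform_count_measure_def using fin by (intro integrable_point_measure_finite)
  ultimately show ?thesis
    using M fin unfolding P_operator_def
    by (auto simp: AE_uniform_count_measure adj_operator_def sum.distrib sum_distrib_left intro!: sum.cong)
qed

lemma finite_simple_graph_cone:
  assumes "finite_simple_graph G"
  shows "finite_simple_graph (cone_graph G)"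
  using assms unfolding finite_simple_graph_def cone_graph_def
  by (auto simp: card_image card_insert_if)

lemma adj_operator_cone:
  assumes G: "finite_simple_graph G" and x: "x \<in> verts G"
  shows "adj_operator (cone_graph G) v (Some x) = adj_operator G (\<lambda>y. v (Some y)) x + v None"
proof -
  have edge: "{Some x, Some y} \<in> (\<lambda>e. Some ` e) ` edges G \<longleftrightarrow> {x, y} \<in> edges G" for y
  proof
    assume "{Some x, Some y} \<in> (\<lambda>e. Some ` e) ` edges G"
    then obtain e where e: "e \<in> edges G" "Some ` {x, y} = Some ` e" by auto
    then have "{x, y} = e" by (simp only: inj_image_eq_iff[OF inj_Some])
    then show "{x, y} \<in> edges G" using e by simp
  next
    assume "{x, y} \<in> edges G"
    then have "Some ` {x, y} \<in> (\<lambda>e. Some ` e) ` edges G" by (rule imageI)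
    then show "{Some x, Some y} \<in> (\<lambda>e. Some ` e) ` edges G" by simp
  qed
  have "{y \<in> verts (cone_graph G). {Some x, y} \<in> edges (cone_graph G)}
      = insert None (Some ` {y \<in> verts G. {x, y} \<in> edges G})"
    using x edge by (auto simp: cone_graph_def doubleton_eq_iff)
  then show ?thesis
    using G by (simp add: adj_operator_def finite_simple_graph_def sum.reindex add.commute)
qed

lemma verts_cone_graph: "verts (cone_graph G) = insert None (Some ` verts G)"
  by (simp add: cone_graph_def)

text \<open>The added point has mass \<open>1 / (card V + 1)\<close>, and no event changes its
  probability by more, whatever value \<open>X\<close> takes there. This matters because the cone
  operator at the new vertex sums over all old vertices and can be as large as their number.\<close>

lemma LP_close_insert_point:
  assumes V: "finite V" "V \<noteq> {}"
    and X: "X \<in> measurable (uniform_count_measure (insert None (Some ` V))) (euclid d)"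
  shows "LP_close d (1 / (real (card V) + 1))
    (distr (uniform_count_measure (insert None (Some ` V))) (euclid d) X)
    (distr (uniform_count_measure V) (euclid d) (\<lambda>x. X (Some x)))"
proof -
  let ?W = "insert None (Some ` V)" and ?n = "real (card V)"
  let ?\<epsilon> = "1 / (?n + 1)"
  let ?\<eta> = "distr (uniform_count_measure ?W) (euclid d) X"
  let ?\<mu> = "distr (uniform_count_measure V) (euclid d) (\<lambda>x. X (Some x))"
  have n: "0 < ?n" using V by (simp add: card_gt_0_iff)
  have cardW: "card ?W = card V + 1" using V by (simp add: card_image)
  have Y: "(\<lambda>x. X (Some x)) \<in> measurable (uniform_count_measure V) (euclid d)"
    using measurable_space[OF X] V by (simp add: uniform_count_measure_def space_point_measure)
  have P: "euclid_prob d ?\<eta>" "euclid_prob d ?\<mu>"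
    using X Y V by (auto intro!: euclid_prob_distr prob_space_uniform_count_measure)
  have diff: "\<bar>measure ?\<eta> U - measure ?\<mu> U\<bar> \<le> ?\<epsilon>" if U: "U \<in> sets (euclid d)" for U
  proof -
    define S where "S = {x \<in> V. X (Some x) \<in> U}"
    define a where "a = real (card S)"
    define e :: real where "e = (if X None \<in> U then 1 else 0)"
    have "finite S" using V by (simp add: S_def)
    have "a \<le> ?n" unfolding a_def S_def using V by (auto intro!: card_mono)
    have mu: "measure ?\<mu> U = a / ?n"
      using U Y V by (simp add: measure_distr space_uniform_count_measure measure_uniform_count_measure
        a_def S_def vimage_def Int_def conj_commute)
    have "X -` U \<inter> ?W = Some ` S \<union> (if X None \<in> U then {None} else {})"
      by (auto simp: S_def)
    then have "real (card (X -` U \<inter> ?W)) = a + e"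
      using \<open>finite S\<close> by (auto simp: a_def e_def card_image card_insert_if)
    moreover have "measure ?\<eta> U = real (card (X -` U \<inter> ?W)) / real (card ?W)"
      using U X V by (simp add: measure_distr space_uniform_count_measure measure_uniform_count_measure)
    ultimately have eta: "measure ?\<eta> U = (a + e) / (?n + 1)" by (simp add: cardW)
    \<comment> \<open>Both \<open>e\<close> and \<open>a / ?n\<close> lie in [0, 1], so the
      numerator is at most 1 in absolute value.\<close>
    have "measure ?\<eta> U - measure ?\<mu> U = (e - a / ?n) / (?n + 1)"
      unfolding eta mu using n by (simp add: divide_simps) (simp add: algebra_simps)
    moreover have "\<bar>e - a / ?n\<bar> \<le> 1"
    proof -
      have "0 \<le> a / ?n" "a / ?n \<le> 1" using \<open>a \<le> ?n\<close> n by (auto simp: a_def)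
      moreover have "0 \<le> e" "e \<le> 1" by (auto simp: e_def)
      ultimately show ?thesis by linarith
    qed
    ultimately show ?thesis using n by (simp add: abs_divide divide_right_mono)
  qed
  have sub: "measure \<theta> U \<le> measure \<theta> (open_nbhd d ?\<epsilon> U)" if "U \<in> sets (euclid d)" "euclid_prob d \<theta>" for U \<theta>
    using that n by (intro euclid_prob_mono subset_open_nbhd open_nbhd_in_sets) auto
  show ?thesis
    unfolding LP_close_def
  proof (intro ballI conjI)
    fix U assume U: "U \<in> sets (euclid d)"
    show "measure ?\<eta> U \<le> measure ?\<mu> (open_nbhd d ?\<epsilon> U) + ?\<epsilon>"
      using diff[OF U] sub[OF U P(2)] by linarith
    show "measure ?\<mu> U \<le> measure ?\<eta> (open_nbhd d ?\<epsilon> U) + ?\<epsilon>"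
      using diff[OF U] sub[OF U P(1)] by linarith
  qed
qed

definition image_shift :: "nat \<Rightarrow> (nat \<Rightarrow> real) \<Rightarrow> nat \<Rightarrow> real" where
  "image_shift k c i = (if i < k then 0 else c (i - k))"

text \<open>A scalar functional moves the image coordinates by an amount that does not depend on
  \<omega>, so it acts on the profile vector as a translation.\<close>

lemma profile_vec_add_functional:
  assumes "\<And>i. i < k \<Longrightarrow> \<psi> (g i) = c i"
  shows "profile_vec (\<lambda>g \<omega>. A g \<omega> + \<psi> g) k g \<omega> = translate (2 * k) (image_shift k c) (profile_vec A k g \<omega>)"
  using assms by (auto simp: profile_vec_def translate_def image_shift_def fun_eq_iff restrict_def)

text \<open>On the old vertices the cone operator adds the constant \<open>f i None\<close>, the
  same kind of translation as in \<open>profile_vec_add_functional\<close>; the new vertex is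
  discarded at the price of its mass.\<close>

lemma LP_close_cone:
  assumes G: "finite_simple_graph G"
    and f: "\<forall>i<k. f i \<in> Linf_ball (uniform_count_measure (verts (cone_graph G)))"
    and c: "\<And>i. i < k \<Longrightarrow> f i None = c i"
  shows "LP_close (2 * k) (1 / (real (card (verts G)) + 1))
    (joint_distr (uniform_count_measure (verts (cone_graph G))) (adj_operator (cone_graph G)) k f)
    (distr (uniform_count_measure (verts G)) (euclid (2 * k))
      (\<lambda>x. translate (2 * k) (image_shift k c) (profile_vec (adj_operator G) k (\<lambda>i x. f i (Some x)) x)))"
proof -
  have V: "finite (verts G)" "verts G \<noteq> {}" using G by (auto simp: finite_simple_graph_def)
  let ?X = "profile_vec (adj_operator (cone_graph G)) k f"
  have "?X \<in> measurable (uniform_count_measure (verts (cone_graph G))) (euclid (2 * k))"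
    by (rule measurable_profile_vec[OF P_operator_adj_operator[OF finite_simple_graph_cone[OF G]] f])
  from LP_close_insert_point[OF V this[unfolded verts_cone_graph]]
  have "LP_close (2 * k) (1 / (real (card (verts G)) + 1))
    (joint_distr (uniform_count_measure (verts (cone_graph G))) (adj_operator (cone_graph G)) k f)
    (distr (uniform_count_measure (verts G)) (euclid (2 * k)) (\<lambda>x. ?X (Some x)))"
    by (simp add: joint_distr_eq verts_cone_graph)
  moreover have "?X (Some x) = translate (2 * k) (image_shift k c) (profile_vec (adj_operator G) k (\<lambda>i x. f i (Some x)) x)"
    if "x \<in> verts G" for x
    using adj_operator_cone[OF G that] c
    by (auto simp: profile_vec_def translate_def image_shift_def fun_eq_iff restrict_def)
  then have "distr (uniform_count_measure (verts G)) (euclid (2 * k)) (\<lambda>x. ?X (Some x)) =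
    distr (uniform_count_measure (verts G)) (euclid (2 * k))
      (\<lambda>x. translate (2 * k) (image_shift k c) (profile_vec (adj_operator G) k (\<lambda>i x. f i (Some x)) x))"
    by (intro distr_cong) (auto simp: space_uniform_count_measure)
  ultimately show ?thesis by simp
qed

section \<open>Overwriting functions on a small set\<close>

lemma sum_lessThan_add:
  fixes f :: "nat \<Rightarrow> real"
  shows "(\<Sum>i<m + n. f i) = (\<Sum>i<m. f i) + (\<Sum>i<n. f (m + i))"
  by (induction n) (simp_all add: add.assoc)

lemma euclid_dist_profile_vec_le:
  "euclid_dist (2 * k) (profile_vec A k f \<omega>) (profile_vec A k g \<omega>)
    \<le> (\<Sum>i<k. \<bar>f i \<omega> - g i \<omega>\<bar>) + (\<Sum>i<k. \<bar>A (f i) \<omega> - A (g i) \<omega>\<bar>)"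
proof -
  have "euclid_dist (2 * k) (profile_vec A k f \<omega>) (profile_vec A k g \<omega>)
      \<le> (\<Sum>i<k + k. \<bar>profile_vec A k f \<omega> i - profile_vec A k g \<omega> i\<bar>)"
    using euclid_dist_le_sum[of "2 * k"] by (simp add: mult_2)
  also have "\<dots> = (\<Sum>i<k. \<bar>f i \<omega> - g i \<omega>\<bar>) + (\<Sum>i<k. \<bar>A (f i) \<omega> - A (g i) \<omega>\<bar>)"
    unfolding sum_lessThan_add
    by (intro arg_cong2[where f = "(+)"] sum.cong) (auto simp: profile_vec_def)
  finally show ?thesis .
qed

lemma overwrite_in_Linf_ball:
  assumes "f \<in> Linf_ball M" "\<bar>d\<bar> \<le> 1" "R \<in> sets M"
  shows "(\<lambda>x. if x \<in> R then d else f x) \<in> Linf_ball M"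
proof -
  have [measurable]: "f \<in> borel_measurable M" "R \<in> sets M" using assms by (auto simp: Linf_ball_iff)
  have "AE x in M. \<bar>f x\<bar> \<le> 1" using assms by (simp add: Linf_ball_iff)
  then have "AE x in M. \<bar>if x \<in> R then d else f x\<bar> \<le> 1"
    by eventually_elim (use assms in auto)
  then show ?thesis by (simp add: Linf_ball_iff)
qed

text \<open>The exceptional set consists of \<open>R\<close>, where the functions change, and of the
  points where the images change by \<open>e\<close> or more in total. Each image moves by at most
  \<open>2 * \<delta>\<close> in the mean, so Markov's inequality bounds the second set by
  \<open>2 * k * \<delta> / e\<close>; this is the origin of the assumption on
  \<open>e\<close>.\<close>

lemma LP_close_overwrite:
  assumes A: "P_operator M A" and g: "\<forall>i<k. g i \<in> Linf_ball M" and d: "\<forall>i<k. \<bar>d i\<bar> \<le> 1"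
    and R: "R \<in> sets M" "small_on M A R \<delta>"
    and e: "0 < e" "measure M R + 2 * real k * \<delta> / e \<le> e"
  shows "LP_close (2 * k) e (joint_distr M A k g) (joint_distr M A k (\<lambda>i x. if x \<in> R then d i else g i x))"
proof -
  interpret prob_space M using P_operator_imp_prob_space[OF A] .
  define g' where "g' i x = (if x \<in> R then d i else g i x)" for i x
  have g': "\<forall>i<k. g' i \<in> Linf_ball M"
    unfolding g'_def using g d R by (auto intro: overwrite_in_Linf_ball)
  have L: "g i \<in> Linf M" "g' i \<in> Linf M" if "i < k" for i
    using g g' that Linf_ball_subset_Linf by blast+
  have int: "integrable M (\<lambda>x. \<bar>A (g i) x - A (g' i) x\<bar>)" if "i < k" for i
    using P_operatorD(1)[OF A] L[OF that] by auto
  have small: "(\<integral>x. \<bar>A (g i) x - A (g' i) x\<bar> \<partial>M) \<le> 2 * \<delta>" if i: "i < k" for i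
  proof -
    \<comment> \<open>\<open>\<bar>g i x - d i\<bar>\<close> can reach 2, so the difference is
      halved to stay below the indicator of \<open>R\<close>; the factor 2 returns in the
      bound.\<close>
    define h where "h = (\<lambda>x. (1 / 2) * (g i x - g' i x))"
    have diff: "(\<lambda>x. g i x - g' i x) \<in> Linf M"
      using Linf_add[OF prob_space_axioms L(1)[OF i] Linf_cmult[OF prob_space_axioms L(2)[OF i], of "-1"]] by simp
    have h: "h \<in> Linf M" unfolding h_def by (rule Linf_cmult[OF prob_space_axioms diff])
    have "AE x in M. \<bar>g i x\<bar> \<le> 1" using g i by (simp add: Linf_ball_iff)
    then have "AE x in M. \<bar>h x\<bar> \<le> indicator R x"
    proof eventually_elim
      case (elim x)
      have "\<bar>d i\<bar> \<le> 1" using d i by simp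
      with elim have "\<bar>g i x - d i\<bar> \<le> 2" by linarith
      then show ?case by (simp add: h_def g'_def abs_mult)
    qed
    then have hs: "L1_norm M (A h) \<le> \<delta>" using R(2) Linf_measurable[OF h] by (simp add: small_on_def)
    have "AE x in M. \<bar>A (g i) x - A (g' i) x\<bar> = 2 * \<bar>A h x\<bar>"
      using P_operator_diff[OF A L(1)[OF i] L(2)[OF i]] P_operatorD(4)[OF A diff, of "1/2"]
      by eventually_elim (simp add: h_def)
    then have "(\<integral>x. \<bar>A (g i) x - A (g' i) x\<bar> \<partial>M) = (\<integral>x. 2 * \<bar>A h x\<bar> \<partial>M)"
      using int[OF i] P_operatorD(1)[OF A h] by (intro integral_cong_AE) auto
    then show ?thesis using hs by (simp add: L1_norm_def)
  qed
  define u where "u x = (\<Sum>i<k. \<bar>A (g i) x - A (g' i) x\<bar>)" for x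
  have u_int: "integrable M u" unfolding u_def using int by (intro Bochner_Integration.integrable_sum) auto
  have "integral\<^sup>L M u = (\<Sum>i<k. \<integral>x. \<bar>A (g i) x - A (g' i) x\<bar> \<partial>M)"
    unfolding u_def using int by (intro Bochner_Integration.integral_sum) auto
  also have "\<dots> \<le> (\<Sum>i<k. 2 * \<delta>)" by (rule sum_mono) (use small in auto)
  finally have u_le: "integral\<^sup>L M u \<le> 2 * real k * \<delta>" by simp
  define B where "B = R \<union> {x \<in> space M. e \<le> u x}"
  have Bs: "{x \<in> space M. e \<le> u x} \<in> sets M" using borel_measurable_integrable[OF u_int] by measurable
  have "0 \<le> u x" for x by (simp add: u_def sum_nonneg)
  then have "measure M {x \<in> space M. e \<le> u x} \<le> integral\<^sup>L M u / e"
    using u_int e by (intro integral_Markov_inequality_measure[where A = "{}"]) auto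
  also have "\<dots> \<le> 2 * real k * \<delta> / e" using u_le e by (intro divide_right_mono) auto
  finally have "measure M B \<le> e"
    using measure_Un_le[of R M "{x \<in> space M. e \<le> u x}"] R Bs e by (simp add: B_def)
  moreover have "euclid_dist (2 * k) (profile_vec A k g \<omega>) (profile_vec A k g' \<omega>) < e" if "\<omega> \<in> space M - B" for \<omega>
  proof -
    have "(\<Sum>i<k. \<bar>g i \<omega> - g' i \<omega>\<bar>) = 0" using that by (simp add: g'_def B_def)
    moreover have "u \<omega> < e" using that by (auto simp: B_def)
    ultimately show ?thesis using euclid_dist_profile_vec_le[of k A g \<omega> g'] by (simp add: u_def)
  qed
  moreover have "B \<in> sets M" using R Bs by (simp add: B_def)
  ultimately have "LP_close (2 * k) e (joint_distr M A k g) (joint_distr M A k g')"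
    unfolding joint_distr_eq
    by (intro LP_close_distr[where B = B] prob_space_axioms measurable_profile_vec[OF A] g g')
  then show ?thesis by (simp add: g'_def[abs_def])
qed

text \<open>Error budget: \<open>e\<close> for discarding the new vertex, \<open>e\<close> for
  passing from the graph to \<open>A\<close>, and \<open>e\<close> for overwriting. The last is
  spent only from the cone to the perturbed operator; in the other direction the new vertex can be
  given the value \<open>\<psi> (g i)\<close> exactly.\<close>

lemma hausdorff_profile_cone_le:
  assumes G: "finite_simple_graph G" and A: "P_operator M A"
    and A': "P_operator M (\<lambda>g \<omega>. A g \<omega> + \<psi> g)"
    and e: "0 < e" "1 / (real (card (verts G)) + 1) \<le> e"
    and H: "hausdorff_dist (LP_dist (2 * k)) (profile (uniform_count_measure (verts G)) (adj_operator G) k)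
      (profile M A k) < e"
    and R: "R \<in> sets M" "small_on M A R \<delta>" "measure M R + 2 * real k * \<delta> / e \<le> e"
    and \<psi>_le: "\<And>g. g \<in> Linf_ball M \<Longrightarrow> \<bar>\<psi> g\<bar> \<le> 1"
    and \<psi>_onto: "\<And>g c. g \<in> Linf_ball M \<Longrightarrow> \<bar>c\<bar> \<le> 1 \<Longrightarrow>
      \<exists>d. \<bar>d\<bar> \<le> 1 \<and> \<psi> (\<lambda>x. if x \<in> R then d else g x) = c"
  shows "hausdorff_dist (LP_dist (2 * k))
    (profile (uniform_count_measure (verts (cone_graph G))) (adj_operator (cone_graph G)) k)
    (profile M (\<lambda>g \<omega>. A g \<omega> + \<psi> g) k) \<le> 3 * e"
proof -
  let ?N = "uniform_count_measure (verts G)" and ?N' = "uniform_count_measure (verts (cone_graph G))"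
  let ?B = "adj_operator G" and ?B' = "adj_operator (cone_graph G)"
  let ?E = "euclid (2 * k)"
  have V: "finite (verts G)" "finite (verts (cone_graph G))"
    using G by (auto simp: finite_simple_graph_def verts_cone_graph)
  have B: "P_operator ?N ?B" by (rule P_operator_adj_operator[OF G])
  have B': "P_operator ?N' ?B'" by (rule P_operator_adj_operator[OF finite_simple_graph_cone[OF G]])
  have M: "prob_space M" and N: "prob_space ?N"
    using P_operator_imp_prob_space[OF A] P_operator_imp_prob_space[OF B] .
  define T where "T c = translate (2 * k) (image_shift k c)" for c
  have Tm: "(\<lambda>x. T c (X x)) \<in> measurable L ?E" if "X \<in> measurable L ?E" for c X and L :: "'z measure"
    unfolding T_def using measurable_compose[OF that measurable_translate] .
  \<comment> \<open>The target is the profile vector of \<open>A\<close> translated by the values at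
    the new vertex. It need not come from the perturbed operator yet, since
    \<open>\<psi> (g i)\<close> may differ from \<open>c i\<close>.\<close>
  have chain: "LP_close (2 * k) (2 * e) (joint_distr ?N' ?B' k f)
      (distr M ?E (\<lambda>\<omega>. T c (profile_vec A k g \<omega>)))"
    if f: "\<forall>i<k. f i \<in> Linf_ball ?N'" and g: "\<forall>i<k. g i \<in> Linf_ball M"
      and c: "\<And>i. i < k \<Longrightarrow> f i None = c i"
      and close: "LP_close (2 * k) e (joint_distr ?N ?B k (\<lambda>i x. f i (Some x))) (joint_distr M A k g)"
    for f g c
  proof -
    have f': "\<forall>i<k. (\<lambda>x. f i (Some x)) \<in> Linf_ball ?N"
      using f V by (auto simp: Linf_ball_uniform_count_measure verts_cone_graph)
    have mf: "profile_vec ?B k (\<lambda>i x. f i (Some x)) \<in> measurable ?N ?E"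
      by (rule measurable_profile_vec[OF B f'])
    have mg: "profile_vec A k g \<in> measurable M ?E" by (rule measurable_profile_vec[OF A g])
    have pf: "euclid_prob (2 * k) (joint_distr ?N' ?B' k f)"
      using f by (intro euclid_prob_profile[OF B']) (auto simp: profile_def)
    have pT: "euclid_prob (2 * k) (distr ?N ?E (\<lambda>x. T c (profile_vec ?B k (\<lambda>i x. f i (Some x)) x)))"
      "euclid_prob (2 * k) (distr M ?E (\<lambda>\<omega>. T c (profile_vec A k g \<omega>)))"
      by (intro euclid_prob_distr N M Tm mf mg)+
    have "LP_close (2 * k) e (joint_distr ?N' ?B' k f)
        (distr ?N ?E (\<lambda>x. T c (profile_vec ?B k (\<lambda>i x. f i (Some x)) x)))"
      using LP_close_mono[OF LP_close_cone[OF G f c] e(2) pf] pT(1) by (simp add: T_def)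
    moreover have "LP_close (2 * k) e (distr ?N ?E (\<lambda>x. T c (profile_vec ?B k (\<lambda>i x. f i (Some x)) x)))
        (distr M ?E (\<lambda>\<omega>. T c (profile_vec A k g \<omega>)))"
      unfolding T_def by (rule LP_close_translate[OF close[unfolded joint_distr_eq] N M mf mg])
    ultimately have "LP_close (2 * k) (e + e) (joint_distr ?N' ?B' k f)
        (distr M ?E (\<lambda>\<omega>. T c (profile_vec A k g \<omega>)))"
      using pf pT(2) by (rule LP_close_trans)
    then show ?thesis by simp
  qed
  have joint': "joint_distr M (\<lambda>g \<omega>. A g \<omega> + \<psi> g) k g = distr M ?E (\<lambda>\<omega>. T c (profile_vec A k g \<omega>))"
    if "\<And>i. i < k \<Longrightarrow> \<psi> (g i) = c i" for g c
    unfolding joint_distr_eq T_def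
    by (rule distr_cong) (simp_all add: profile_vec_add_functional[where \<psi> = \<psi>, OF that])
  show ?thesis
  proof (rule hausdorff_profile_le[OF B' A'])
    show "0 < 3 * e" using e by simp
  next
    fix f assume f: "\<forall>i<k. f i \<in> Linf_ball ?N'"
    define c where "c i = f i None" for i
    have c: "\<bar>c i\<bar> \<le> 1" if "i < k" for i
      using f that V by (auto simp: Linf_ball_uniform_count_measure verts_cone_graph c_def)
    have f': "\<forall>i<k. (\<lambda>x. f i (Some x)) \<in> Linf_ball ?N"
      using f V by (auto simp: Linf_ball_uniform_count_measure verts_cone_graph)
    obtain g where g: "\<forall>i<k. g i \<in> Linf_ball M"
      and close: "LP_close (2 * k) e (joint_distr ?N ?B k (\<lambda>i x. f i (Some x))) (joint_distr M A k g)"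
      using hausdorff_profile_less_imp_close(1)[OF B A H f'] by auto
    \<comment> \<open>The mismatch is repaired by overwriting \<open>g i\<close> on \<open>R\<close>
      with a constant for which \<psi> takes the prescribed value \<open>c i\<close>.\<close>
    have "\<exists>d. i < k \<longrightarrow> \<bar>d\<bar> \<le> 1 \<and> \<psi> (\<lambda>x. if x \<in> R then d else g i x) = c i" for i
      using \<psi>_onto[of "g i" "c i"] g c by auto
    then obtain d where d: "\<And>i. i < k \<Longrightarrow> \<bar>d i\<bar> \<le> 1"
      "\<And>i. i < k \<Longrightarrow> \<psi> (\<lambda>x. if x \<in> R then d i else g i x) = c i"
      by metis
    define g' where "g' i x = (if x \<in> R then d i else g i x)" for i x
    have g': "\<forall>i<k. g' i \<in> Linf_ball M"
      unfolding g'_def using g d R by (auto intro: overwrite_in_Linf_ball)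
    have mg: "profile_vec A k g \<in> measurable M ?E" "profile_vec A k g' \<in> measurable M ?E"
      using measurable_profile_vec[OF A] g g' by auto
    have "LP_close (2 * k) e (joint_distr M A k g) (joint_distr M A k g')"
      unfolding g'_def[abs_def] by (rule LP_close_overwrite[OF A g _ R(1,2) e(1) R(3)]) (use d in auto)
    then have "LP_close (2 * k) e (distr M ?E (\<lambda>\<omega>. T c (profile_vec A k g \<omega>)))
        (distr M ?E (\<lambda>\<omega>. T c (profile_vec A k g' \<omega>)))"
      unfolding T_def joint_distr_eq by (rule LP_close_translate[OF _ M M mg])
    moreover have "distr M ?E (\<lambda>\<omega>. T c (profile_vec A k g' \<omega>)) = joint_distr M (\<lambda>g \<omega>. A g \<omega> + \<psi> g) k g'"
      by (rule joint'[symmetric]) (use d in \<open>simp add: g'_def[abs_def]\<close>)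
    moreover have "euclid_prob (2 * k) (joint_distr ?N' ?B' k f)"
      using f by (intro euclid_prob_profile[OF B']) (auto simp: profile_def)
    moreover have "euclid_prob (2 * k) (distr M ?E (\<lambda>\<omega>. T c (profile_vec A k g' \<omega>)))"
      by (intro euclid_prob_distr M Tm mg)
    moreover have "LP_close (2 * k) (2 * e) (joint_distr ?N' ?B' k f) (distr M ?E (\<lambda>\<omega>. T c (profile_vec A k g \<omega>)))"
      by (rule chain[OF f g _ close]) (simp add: c_def)
    ultimately have "LP_close (2 * k) (2 * e + e) (joint_distr ?N' ?B' k f)
        (joint_distr M (\<lambda>g \<omega>. A g \<omega> + \<psi> g) k g')"
      using LP_close_trans by metis
    then show "\<exists>g. (\<forall>i<k. g i \<in> Linf_ball M) \<and>
        LP_close (2 * k) (3 * e) (joint_distr ?N' ?B' k f) (joint_distr M (\<lambda>g \<omega>. A g \<omega> + \<psi> g) k g)"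
      using g' by auto
  next
    fix g assume g: "\<forall>i<k. g i \<in> Linf_ball M"
    define c where "c i = \<psi> (g i)" for i
    obtain f' where f': "\<forall>i<k. f' i \<in> Linf_ball ?N"
      and close: "LP_close (2 * k) e (joint_distr ?N ?B k f') (joint_distr M A k g)"
      using hausdorff_profile_less_imp_close(2)[OF B A H g] by auto
    \<comment> \<open>The value \<open>\<psi> (g i)\<close> is admissible at the new vertex because
      it lies in [-1, 1].\<close>
    define f where "f i = case_option (c i) (f' i)" for i
    have f: "\<forall>i<k. f i \<in> Linf_ball ?N'"
      using f' g \<psi>_le V by (auto simp: Linf_ball_uniform_count_measure verts_cone_graph f_def c_def)
    have "(\<lambda>i x. f i (Some x)) = f'" by (simp add: f_def fun_eq_iff)
    then have "LP_close (2 * k) (2 * e) (joint_distr ?N' ?B' k f) (distr M ?E (\<lambda>\<omega>. T c (profile_vec A k g \<omega>)))"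
      using close by (intro chain[OF f g]) (auto simp: f_def)
    moreover have "distr M ?E (\<lambda>\<omega>. T c (profile_vec A k g \<omega>)) = joint_distr M (\<lambda>g \<omega>. A g \<omega> + \<psi> g) k g"
      by (rule joint'[symmetric]) (simp add: c_def)
    ultimately have "LP_close (2 * k) (2 * e) (joint_distr ?N' ?B' k f) (joint_distr M (\<lambda>g \<omega>. A g \<omega> + \<psi> g) k g)"
      by simp
    moreover have "euclid_prob (2 * k) (joint_distr ?N' ?B' k f)"
      using f by (intro euclid_prob_profile[OF B']) (auto simp: profile_def)
    moreover have "euclid_prob (2 * k) (joint_distr M (\<lambda>g \<omega>. A g \<omega> + \<psi> g) k g)"
      using g by (intro euclid_prob_profile[OF A']) (auto simp: profile_def)
    ultimately have "LP_close (2 * k) (3 * e) (joint_distr ?N' ?B' k f) (joint_distr M (\<lambda>g \<omega>. A g \<omega> + \<psi> g) k g)"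
      using LP_close_mono[of "2 * k" "2 * e" _ _ "3 * e"] e(1) by simp
    then show "\<exists>f. (\<forall>i<k. f i \<in> Linf_ball ?N') \<and>
        LP_close (2 * k) (3 * e) (joint_distr ?N' ?B' k f) (joint_distr M (\<lambda>g \<omega>. A g \<omega> + \<psi> g) k g)"
      using f by auto
  qed
qed

section \<open>Passage to the limit along the graph sequence\<close>

lemma graphs_action_convergeD:
  assumes "graphs_action_converge G M A" "1 \<le> k"
  shows "(\<lambda>n. hausdorff_dist (LP_dist (2 * k))
    (profile (uniform_count_measure (verts (G n))) (adj_operator (G n)) k) (profile M A k)) \<longlonglongrightarrow> 0"
proof -
  have *: "\<And>n. P_operator (uniform_count_measure (verts (G n))) (adj_operator (G n))" "P_operator M A"
    "(\<lambda>n. action_dist (uniform_count_measure (verts (G n))) (adj_operator (G n)) M A) \<longlonglongrightarrow> 0"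
    using assms(1) by (auto simp: graphs_action_converge_def action_converges_def)
  show ?thesis using action_dist_tendsto_0_iff[where Ms = "\<lambda>n. uniform_count_measure (verts (G n))", OF *(1,2)] *(3) assms(2) by blast
qed

lemma cone_action_converge:
  fixes G :: "nat \<Rightarrow> 'v graph"
  assumes G: "\<And>n. finite_simple_graph (G n)"
    and card: "filterlim (\<lambda>n. card (verts (G n))) at_top sequentially"
    and conv: "graphs_action_converge G M A" and A: "P_operator M A"
    and A': "P_operator M (\<lambda>g \<omega>. A g \<omega> + \<psi> g)"
    and R: "\<And>j. R j \<in> sets M" "(\<lambda>j. measure M (R j)) \<longlonglongrightarrow> 0" "\<And>j. small_on M A (R j) (1 / real (Suc j))"
    and \<psi>_le: "\<And>g. g \<in> Linf_ball M \<Longrightarrow> \<bar>\<psi> g\<bar> \<le> 1"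
    and \<psi>_onto: "\<And>j g c. g \<in> Linf_ball M \<Longrightarrow> \<bar>c\<bar> \<le> 1 \<Longrightarrow>
      \<exists>d. \<bar>d\<bar> \<le> 1 \<and> \<psi> (\<lambda>x. if x \<in> R j then d else g x) = c"
  shows "graphs_action_converge (\<lambda>n. cone_graph (G n)) M (\<lambda>g \<omega>. A g \<omega> + \<psi> g)"
proof -
  have P: "P_operator (uniform_count_measure (verts (G n))) (adj_operator (G n))"
    "P_operator (uniform_count_measure (verts (cone_graph (G n)))) (adj_operator (cone_graph (G n)))" for n
    by (intro P_operator_adj_operator finite_simple_graph_cone G)+
  define h where "h k n = hausdorff_dist (LP_dist (2 * k))
    (profile (uniform_count_measure (verts (cone_graph (G n)))) (adj_operator (cone_graph (G n))) k)
    (profile M (\<lambda>g \<omega>. A g \<omega> + \<psi> g) k)" for k n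
  have "h k \<longlonglongrightarrow> 0" if k: "1 \<le> k" for k
  proof (rule tendstoI)
    fix \<epsilon> :: real assume "0 < \<epsilon>"
    \<comment> \<open>Three errors of size \<open>e\<close> must stay strictly below \<epsilon>. The
      index \<open>j\<close> is fixed before \<open>n\<close>, as the sets \<open>R j\<close> live
      on the limit space.\<close>
    define e where "e = \<epsilon> / 4"
    have e: "0 < e" using \<open>0 < \<epsilon>\<close> by (simp add: e_def)
    have "(\<lambda>j. measure M (R j) + 2 * real k * (1 / real (Suc j)) / e) \<longlonglongrightarrow> 0 + 2 * real k * 0 / e"
      by (intro tendsto_intros R(2) LIMSEQ_inverse_real_of_nat[unfolded inverse_eq_divide]) (use e in auto)
    then have "\<forall>\<^sub>F j in sequentially. measure M (R j) + 2 * real k * (1 / real (Suc j)) / e < e"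
      using e by (intro order_tendstoD(2)) auto
    then obtain j where j: "measure M (R j) + 2 * real k * (1 / real (Suc j)) / e < e"
      by (auto simp: eventually_sequentially)
    have ev1: "\<forall>\<^sub>F n in sequentially. hausdorff_dist (LP_dist (2 * k))
      (profile (uniform_count_measure (verts (G n))) (adj_operator (G n)) k) (profile M A k) < e"
      by (rule order_tendstoD(2)[OF graphs_action_convergeD[OF conv k] e])
    have ev2: "\<forall>\<^sub>F n in sequentially. nat \<lceil>1 / e\<rceil> \<le> card (verts (G n))"
      using card unfolding filterlim_at_top by blast
    show "\<forall>\<^sub>F n in sequentially. dist (h k n) 0 < \<epsilon>"
      using ev1 ev2
    proof eventually_elim
      case (elim n)
      have "1 / e \<le> real (card (verts (G n)))" using elim(2) by linarith
      then have "1 / (real (card (verts (G n))) + 1) \<le> e"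
        using e by (simp add: divide_simps) (simp add: algebra_simps)
      then have "h k n \<le> 3 * e"
        unfolding h_def
        using j by (intro hausdorff_profile_cone_le[OF G A A' e _ elim(1) R(1) R(3)[of j] _ \<psi>_le \<psi>_onto]) auto
      moreover have "0 \<le> h k n"
        unfolding h_def
        by (rule hausdorff_dist_nonneg[OF LP_dist_profile_bounds[OF P(2) A'] profile_nonempty profile_nonempty])
      ultimately show ?case using \<open>0 < \<epsilon>\<close> by (simp add: e_def)
    qed
  qed
  then show ?thesis
    unfolding graphs_action_converge_def action_converges_def action_dist_tendsto_0_iff[OF P(2) A'] h_def
    using P(2) A' by simp
qed

section \<open>Disjoint sets of positive measure in the limit space\<close>

text \<open>Each of the \<open>N div m\<close> complete blocks of length \<open>m\<close>
  contributes one element.\<close>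

lemma card_residue_class_ge:
  fixes N m i :: nat
  assumes "i < m"
  shows "N div m \<le> card {j \<in> {0..<N}. j mod m = i}"
proof -
  have "inj_on (\<lambda>q. i + m * q) {..<N div m}" using assms by (auto simp: inj_on_def)
  moreover have "(\<lambda>q. i + m * q) ` {..<N div m} \<subseteq> {j \<in> {0..<N}. j mod m = i}"
  proof safe
    fix q assume "q < N div m"
    then have "m * Suc q \<le> m * (N div m)" by (intro mult_le_mono2) simp
    also have "\<dots> \<le> N" by simp
    finally show "i + m * q \<in> {0..<N}" using assms by simp
  qed (use assms in simp)
  ultimately have "card {..<N div m} \<le> card {j \<in> {0..<N}. j mod m = i}"
    by (intro card_inj_on_le) auto
  then show ?thesis by simp
qed

text \<open>The test functions on \<open>V(G\<^sub>n)\<close> are equidistributed on \<open>m\<close> values; a function on the limit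
  space with a nearby distribution has \<open>m\<close> disjoint level sets of positive measure.\<close>

lemma graph_limit_many_disjoint:
  fixes G :: "nat \<Rightarrow> 'v graph"
  assumes G: "\<And>n. finite_simple_graph (G n)"
    and card: "filterlim (\<lambda>n. card (verts (G n))) at_top sequentially"
    and conv: "graphs_action_converge G M A" and A: "P_operator M A"
  shows "\<exists>\<E>. finite \<E> \<and> m \<le> card \<E> \<and> disjoint \<E> \<and> \<E> \<subseteq> sets M \<and> (\<forall>E\<in>\<E>. 0 < measure M E)"
proof (cases "m = 0")
  case True
  then show ?thesis by (intro exI[of _ "{}"]) auto
next
  case False
  then have m: "0 < real m" by simp
  interpret prob_space M using P_operator_imp_prob_space[OF A] .
  \<comment> \<open>Two demands meet here: levels at distance \<open>1 / m\<close> must have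
    disjoint neighbourhoods of radius \<epsilon>, and a level of mass at least
    \<open>1 / (2 * m) = 2 * \<epsilon>\<close> must keep positive mass after the Levy-Prokhorov
    loss of \<epsilon>.\<close>
  define \<epsilon> where "\<epsilon> = 1 / (4 * real m)"
  have \<epsilon>: "0 < \<epsilon>" using m by (simp add: \<epsilon>_def)
  have "\<forall>\<^sub>F n in sequentially. hausdorff_dist (LP_dist (2 * 1))
      (profile (uniform_count_measure (verts (G n))) (adj_operator (G n)) 1) (profile M A 1) < \<epsilon>"
    by (rule order_tendstoD(2)[OF graphs_action_convergeD[OF conv] \<epsilon>]) simp
  moreover have "\<forall>\<^sub>F n in sequentially. m \<le> card (verts (G n))"
    using card by (simp add: filterlim_at_top)
  ultimately have "\<forall>\<^sub>F n in sequentially. hausdorff_dist (LP_dist (2 * 1))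
      (profile (uniform_count_measure (verts (G n))) (adj_operator (G n)) 1) (profile M A 1) < \<epsilon>
      \<and> m \<le> card (verts (G n))"
    by (rule eventually_conj)
  then obtain n where n: "hausdorff_dist (LP_dist (2 * 1))
      (profile (uniform_count_measure (verts (G n))) (adj_operator (G n)) 1) (profile M A 1) < \<epsilon>"
    "m \<le> card (verts (G n))"
    by (auto simp: eventually_sequentially)
  define V where "V = verts (G n)"
  define N where "N = card V"
  let ?N = "uniform_count_measure V"
  have V: "finite V" "V \<noteq> {}" using G[of n] by (auto simp: finite_simple_graph_def V_def)
  have B: "P_operator ?N (adj_operator (G n))" unfolding V_def by (rule P_operator_adj_operator[OF G])
  obtain b where b: "bij_betw b V {0..<N}" using ex_bij_betw_finite_nat[OF V(1)] by (auto simp: N_def)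
  define f where "f i x = real (b x mod m) / real m" for i :: nat and x
  have f: "\<forall>i<1. f i \<in> Linf_ball ?N"
    using False V by (auto simp: Linf_ball_uniform_count_measure f_def intro: less_imp_le)
  obtain g where g: "\<forall>i<1. g i \<in> Linf_ball M"
    and close: "LP_close (2 * 1) \<epsilon> (joint_distr ?N (adj_operator (G n)) 1 f) (joint_distr M A 1 g)"
    using hausdorff_profile_less_imp_close(1)[OF B A n(1)[folded V_def] f] by auto
  have [measurable]: "g 0 \<in> borel_measurable M" using g by (simp add: Linf_ball_iff)
  define E where "E i = {\<omega> \<in> space M. \<bar>g 0 \<omega> - real i / real m\<bar> < \<epsilon>}" for i
  have Es: "E i \<in> sets M" for i unfolding E_def by measurable
  have Epos: "0 < measure M (E i)" if i: "i < m" for i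
  proof -
    define U where "U = {x \<in> space (euclid (2 * 1)). x 0 = real i / real m}"
    have U: "U \<in> sets (euclid (2 * 1))" unfolding U_def by measurable
    have mf: "profile_vec (adj_operator (G n)) 1 f \<in> measurable ?N (euclid (2 * 1))"
      by (rule measurable_profile_vec[OF B f])
    have mg: "profile_vec A 1 g \<in> measurable M (euclid (2 * 1))"
      by (rule measurable_profile_vec[OF A g])
    have "profile_vec (adj_operator (G n)) 1 f -` U \<inter> V = {x \<in> V. b x mod m = i}"
      using measurable_space[OF mf] False
      by (auto simp: U_def space_uniform_count_measure profile_vec_def f_def)
    moreover have "card {x \<in> V. b x mod m = i} = card {j \<in> {0..<N}. j mod m = i}"
    proof (rule bij_betw_same_card)
      show "bij_betw b {x \<in> V. b x mod m = i} {j \<in> {0..<N}. j mod m = i}"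
        using b by (auto simp: bij_betw_def inj_on_def)
    qed
    ultimately have lower: "real (N div m) / real N \<le> measure (joint_distr ?N (adj_operator (G n)) 1 f) U"
      using V U mf card_residue_class_ge[OF i, of N]
      by (simp add: joint_distr_eq measure_distr space_uniform_count_measure measure_uniform_count_measure
        N_def divide_right_mono)
    \<comment> \<open>Rounding in \<open>N div m\<close> loses at most a factor 2, because
      \<open>m \<le> N\<close>.\<close>
    have "N < m * (N div m) + m" using False by (metis add.commute dividend_less_times_div gr0I)
    moreover have "m \<le> m * (N div m)" using n(2) False div_le_mono[of m N m] by (simp add: N_def V_def)
    ultimately have "N \<le> 2 * m * (N div m)" by linarith
    then have "real N \<le> real (2 * m * (N div m))" by (simp only: of_nat_le_iff)
    moreover have "0 < real N" using V by (simp add: N_def card_gt_0_iff)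
    ultimately have "1 / (2 * real m) \<le> real (N div m) / real N"
      using m by (simp add: divide_simps) (simp add: mult_ac)
    also note lower
    also have "measure (joint_distr ?N (adj_operator (G n)) 1 f) U
        \<le> measure (joint_distr M A 1 g) (open_nbhd (2 * 1) \<epsilon> U) + \<epsilon>"
      using close U by (simp add: LP_close_def)
    also have "measure (joint_distr M A 1 g) (open_nbhd (2 * 1) \<epsilon> U) \<le> measure M (E i)"
    proof -
      have "profile_vec A 1 g -` open_nbhd (2 * 1) \<epsilon> U \<inter> space M \<subseteq> E i"
      proof
        fix \<omega> assume \<omega>: "\<omega> \<in> profile_vec A 1 g -` open_nbhd (2 * 1) \<epsilon> U \<inter> space M"
        then obtain y where y: "y 0 = real i / real m" "euclid_dist (2 * 1) (profile_vec A 1 g \<omega>) y < \<epsilon>"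
          by (auto simp: open_nbhd_def U_def)
        then have "\<bar>profile_vec A 1 g \<omega> 0 - y 0\<bar> < \<epsilon>"
          using abs_diff_le_euclid_dist[of 0 "2 * 1" "profile_vec A 1 g \<omega>" y] by simp
        then show "\<omega> \<in> E i" using \<omega> y by (simp add: E_def profile_vec_def)
      qed
      then have "measure M (profile_vec A 1 g -` open_nbhd (2 * 1) \<epsilon> U \<inter> space M) \<le> measure M (E i)"
        using Es by (rule finite_measure_mono)
      then show ?thesis unfolding joint_distr_eq by (subst measure_distr[OF mg open_nbhd_in_sets])
    qed
    finally have "1 / (2 * real m) \<le> measure M (E i) + \<epsilon>" by simp
    moreover have "1 / (2 * real m) = 2 * \<epsilon>" by (simp add: \<epsilon>_def)
    ultimately show ?thesis using \<epsilon> by linarith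
  qed
  have disj: "E i \<inter> E j = {}" if "i \<noteq> j" for i j
  proof (rule ccontr)
    assume "E i \<inter> E j \<noteq> {}"
    then obtain \<omega> where "\<bar>g 0 \<omega> - real i / real m\<bar> < \<epsilon>" "\<bar>g 0 \<omega> - real j / real m\<bar> < \<epsilon>"
      by (auto simp: E_def)
    then have "\<bar>real i / real m - real j / real m\<bar> < 2 * \<epsilon>" by linarith
    also have "2 * \<epsilon> = (1 / 2) / real m" by (simp add: \<epsilon>_def)
    finally have "\<bar>real i - real j\<bar> / real m < (1 / 2) / real m"
      using m by (simp add: abs_divide flip: diff_divide_distrib)
    then have "\<bar>real i - real j\<bar> < 1 / 2" using m unfolding divide_less_cancel by blast
    then show False using that by linarith
  qed
  have inj: "inj_on E {..<m}"
  proof (rule inj_onI)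
    fix i j assume "i \<in> {..<m}" "j \<in> {..<m}" and eq: "E i = E j"
    then have "E i \<noteq> {}" using Epos[of i] by force
    then show "i = j" using disj[of i j] eq by auto
  qed
  have "disjoint (E ` {..<m})"
    unfolding disjoint_def by (metis disj imageE)
  then show ?thesis
    by (intro exI[of _ "E ` {..<m}"]) (use Es Epos inj in \<open>auto simp: card_image\<close>)
qed

theorem theorem1p6:
  fixes G :: "nat \<Rightarrow> 'v graph" and \<nu> :: "'a measure" and A :: "'a operator"
  assumes "\<And>n. finite_simple_graph (G n)"
    and "filterlim (\<lambda>n. card (verts (G n))) at_top sequentially"
    and "prob_space \<nu>" and "separable_measure \<nu>"
    and "P_operator \<nu> A"
    and "graphs_action_converge G \<nu> A"
  shows "\<exists>\<F>. measure_filter \<nu> \<F> \<and>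
    (\<forall>\<U>. measure_ultrafilter \<nu> \<U> \<and> \<F> \<subseteq> \<U> \<longrightarrow>
       graphs_action_converge (\<lambda>n. cone_graph (G n)) \<nu> (\<lambda>g \<omega>. A g \<omega> + uf_integral \<nu> \<U> g) \<and>
       graphs_action_converge (\<lambda>n. cone_graph (G n)) \<nu> (\<lambda>g \<omega>. A g \<omega> - uf_integral \<nu> \<U> g))"
proof -
  interpret prob_space \<nu> by fact
  note A = \<open>P_operator \<nu> A\<close>
  obtain S :: "nat \<Rightarrow> 'a set" where S: "disjoint_family S" "\<And>i. S i \<in> sets \<nu>" "\<And>i. 0 < measure \<nu> (S i)"
    using ex_infinite_disjoint_family[OF assms(3) graph_limit_many_disjoint[OF assms(1,2,6,5)]] by blast
  obtain R where R: "\<And>j. R j \<in> sets \<nu>" "\<And>j. 0 < measure \<nu> (R j)" "decseq R"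
    "(\<lambda>j. measure \<nu> (R j)) \<longlonglongrightarrow> 0" "\<And>j. small_on \<nu> A (R j) (1 / real (Suc j))"
    using ex_decseq_small_on[OF A S] by blast
  \<comment> \<open>Every ultrafilter extending \<F> contains all the \<open>R j\<close>, so the
    same sets can be overwritten whichever extension is taken.\<close>
  define \<F> where "\<F> = {T \<in> sets \<nu>. \<exists>j. R j \<subseteq> T}"
  have R_in: "R j \<in> \<F>" for j using R(1) by (auto simp: \<F>_def)
  have "measure_filter \<nu> \<F>"
    unfolding measure_filter_def
  proof (intro conjI ballI impI)
    show "\<F> \<noteq> {}" using R_in by blast
    show "\<F> \<subseteq> sets \<nu>" by (auto simp: \<F>_def)
    show "0 < measure \<nu> T" if "T \<in> \<F>" for T
      using that finite_measure_mono[of "R j" T for j] R(2) by (fastforce simp: \<F>_def intro: less_le_trans)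
    show "T \<inter> T' \<in> \<F>" if T: "T \<in> \<F>" "T' \<in> \<F>" for T T'
    proof -
      obtain i j where "R i \<subseteq> T" "R j \<subseteq> T'" using T by (auto simp: \<F>_def)
      moreover have "R (max i j) \<subseteq> R i" "R (max i j) \<subseteq> R j" using R(3) by (auto simp: decseq_def)
      ultimately show ?thesis using T by (auto simp: \<F>_def intro!: exI[of _ "max i j"])
    qed
    show "T' \<in> \<F>" if "T \<in> \<F>" "T' \<in> sets \<nu>" "T \<subseteq> T'" for T T'
      using that by (auto simp: \<F>_def)
  qed
  moreover have "graphs_action_converge (\<lambda>n. cone_graph (G n)) \<nu> (\<lambda>g \<omega>. A g \<omega> + uf_integral \<nu> \<U> g) \<and>
       graphs_action_converge (\<lambda>n. cone_graph (G n)) \<nu> (\<lambda>g \<omega>. A g \<omega> - uf_integral \<nu> \<U> g)"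
    if U: "measure_ultrafilter \<nu> \<U>" "\<F> \<subseteq> \<U>" for \<U>
  proof -
    note uf = assms(3) U(1)
    \<comment> \<open>One argument for both signs: \<open>s\<close> is its own inverse, so making
      \<open>s * uf_integral \<nu> \<U> g\<close> equal to \<open>c\<close> means overwriting by
      \<open>s * c\<close>, which again lies in [-1, 1].\<close>
    have signed: "graphs_action_converge (\<lambda>n. cone_graph (G n)) \<nu> (\<lambda>g \<omega>. A g \<omega> + s * uf_integral \<nu> \<U> g)"
      if s: "s * s = 1" "\<bar>s\<bar> = 1" for s :: real
    proof (rule cone_action_converge[OF assms(1,2,6) A _ R(1,4,5)])
      show "P_operator \<nu> (\<lambda>g \<omega>. A g \<omega> + s * uf_integral \<nu> \<U> g)"
      proof (rule P_operator_add_functional[OF A])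
        show "s * uf_integral \<nu> \<U> f = s * uf_integral \<nu> \<U> g"
          if "f \<in> Linf \<nu>" "g \<in> Linf \<nu>" "AE x in \<nu>. f x = g x" for f g
          using uf_integral_cong_AE[OF uf that] by simp
        show "s * uf_integral \<nu> \<U> (\<lambda>x. f x + g x) = s * uf_integral \<nu> \<U> f + s * uf_integral \<nu> \<U> g"
          if "f \<in> Linf \<nu>" "g \<in> Linf \<nu>" for f g
          using uf_integral_add[OF uf that] by (simp add: distrib_left)
        show "s * uf_integral \<nu> \<U> (\<lambda>x. c * f x) = c * (s * uf_integral \<nu> \<U> f)" if "f \<in> Linf \<nu>" for c f
          using uf_integral_cmult[OF uf that] by simp
        show "\<bar>s * uf_integral \<nu> \<U> f\<bar> \<le> K" if "f \<in> Linf \<nu>" "AE x in \<nu>. \<bar>f x\<bar> \<le> K" for f K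
          using uf_integral_abs_le[OF uf that] s by (simp add: abs_mult)
      qed
      show "\<bar>s * uf_integral \<nu> \<U> g\<bar> \<le> 1" if "g \<in> Linf_ball \<nu>" for g
        using uf_integral_abs_le[OF uf, of g 1] that Linf_ball_subset_Linf[of \<nu>] s
        by (auto simp: abs_mult Linf_ball_iff)
      show "\<exists>d. \<bar>d\<bar> \<le> 1 \<and> s * uf_integral \<nu> \<U> (\<lambda>x. if x \<in> R j then d else g x) = c"
        if g: "g \<in> Linf_ball \<nu>" and c: "\<bar>c\<bar> \<le> 1" for j g c
      proof (intro exI conjI)
        show sc: "\<bar>s * c\<bar> \<le> 1" using s c by (simp add: abs_mult)
        have "(\<lambda>x. if x \<in> R j then s * c else g x) \<in> Linf \<nu>"
          using overwrite_in_Linf_ball[OF g sc R(1)] Linf_ball_subset_Linf by blast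
        then have "uf_integral \<nu> \<U> (\<lambda>x. if x \<in> R j then s * c else g x) = s * c"
          using R_in U(2) by (intro uf_integral_const_on[OF uf, of _ "R j"]) auto
        then show "s * uf_integral \<nu> \<U> (\<lambda>x. if x \<in> R j then s * c else g x) = c"
          using s by (simp flip: mult.assoc)
      qed
    qed
    show ?thesis using signed[of 1] signed[of "-1"] by simp
  qed
  ultimately show ?thesis by blast
qed

end
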